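(* Let $a_0>0$ and $\ell>0$ be real numbers and let $V_0>\ell a_0^2$. Then $$\sup_{a\in\mathcal V_{a_0,\ell,V_0}}F(a)=+\infty ,$$ and the problem of maximizing $F$ over $\mathcal V_{a_0,\ell,V_0}$ has no solution (i.e. there is no $a\in\mathcal V_{a_0,\ell,V_0}$ attaining the supremum).
   Context: Fix real constants $k>0$, $\beta>0$, $\beta_r\ge 0$ and $0<T_\infty<T_d$. For $a\in W^{1,\infty}(0,\ell)$ with $a\ge a_0>0$ on $[0,\ell]$, let $T\in H^1(0,\ell)$ be the unique solution of $$(a(x)^2T'(x))'=\beta\, a(x)\sqrt{1+a'(x)^2}\,(T(x)-T_\infty),\quad x\in(0,\ell),$$ $$T(0)=T_d,\qquad T'(\ell)=-\beta_r\,(T(\ell)-T_\infty).$$ Define $F(a)=-k\pi\, a(0)^2\,T'(0)$. The admissible class is $$\mathcal V_{a_0,\ell,V_0}=\Big\{a\in W^{1,\infty}(0,\ell):\ a\ge a_0 \text{ a.e. in }[0,\ell],\ \int_0^\ell a(x)^2\,dx\le V_0\Big\}.$$ *)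

theory Defs
  imports "HOL-Analysis.Analysis"
begin

abbreviation leb :: "real \<Rightarrow> real measure"
  where "leb l \<equiv> lebesgue_on {0<..<l}"

definition L2 :: "real \<Rightarrow> (real \<Rightarrow> real) set"
  where "L2 l = {u \<in> borel_measurable (leb l). integrable (leb l) (\<lambda>x. (u x)\<^sup>2)}"

definition Linf :: "real \<Rightarrow> (real \<Rightarrow> real) set"
  where "Linf l = {u \<in> borel_measurable (leb l). \<exists>C. AE x in leb l. \<bar>u x\<bar> \<le> C}"

definition test_function :: "real \<Rightarrow> (real \<Rightarrow> real) \<Rightarrow> bool"
  where "test_function l \<phi> \<longleftrightarrow>
    \<phi> C1_differentiable_on UNIV \<and>
    (\<exists>K. compact K \<and> K \<subseteq> {0<..<l} \<and> (\<forall>x. x \<notin> K \<longrightarrow> \<phi> x = 0))"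

(* Integrability is required explicitly because the Bochner integral of a
   non-integrable function is 0.  It is no restriction for functions in L2 l or
   Linf l, the interval being bounded. *)
definition has_weak_deriv :: "real \<Rightarrow> (real \<Rightarrow> real) \<Rightarrow> (real \<Rightarrow> real) \<Rightarrow> bool"
  where "has_weak_deriv l u g \<longleftrightarrow>
    integrable (leb l) u \<and> integrable (leb l) g \<and>
    (\<forall>\<phi>. test_function l \<phi> \<longrightarrow>
      (LINT x|leb l. u x * deriv \<phi> x) = - (LINT x|leb l. g x * \<phi> x))"

(* First-order Sobolev space over X: H^1(0,l) for X = L2 l and W^{1,infinity}(0,l)
   for X = Linf l.  An element is given by its continuous representative on [0,l],
   so that values at the endpoints make sense; values outside [0,l] are irrelevant. *)
definition W1 :: "real \<Rightarrow> (real \<Rightarrow> real) set \<Rightarrow> (real \<Rightarrow> real) set"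
  where "W1 l X = {u \<in> X. continuous_on {0..l} u \<and> (\<exists>g\<in>X. has_weak_deriv l u g)}"

(* The differential equation is meant in the sense of distributions.  As a is continuous
   and positive and (a^2 T')' is integrable, such a T is C^1 on [0,l]; the boundary
   condition at l is therefore stated with the one-sided derivative. *)
definition temperature_solution ::
    "real \<Rightarrow> real \<Rightarrow> real \<Rightarrow> real \<Rightarrow> real \<Rightarrow> (real \<Rightarrow> real) \<Rightarrow> (real \<Rightarrow> real) \<Rightarrow> bool"
  where "temperature_solution l \<beta> \<beta>r Tinf Td a T \<longleftrightarrow>
    T \<in> W1 l (L2 l) \<and>
    (\<exists>a' T'. has_weak_deriv l a a' \<and> has_weak_deriv l T T' \<and>
       has_weak_deriv l (\<lambda>x. (a x)\<^sup>2 * T' x)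
         (\<lambda>x. \<beta> * a x * sqrt (1 + (a' x)\<^sup>2) * (T x - Tinf))) \<and>
    T 0 = Td \<and>
    (T has_real_derivative - \<beta>r * (T l - Tinf)) (at l within {0..l})"

(* Only the restriction of a solution to [0,l] is determined, hence extensional. *)
definition temperature ::
    "real \<Rightarrow> real \<Rightarrow> real \<Rightarrow> real \<Rightarrow> real \<Rightarrow> (real \<Rightarrow> real) \<Rightarrow> real \<Rightarrow> real"
  where "temperature l \<beta> \<beta>r Tinf Td a =
    (THE T. T \<in> extensional {0..l} \<and> temperature_solution l \<beta> \<beta>r Tinf Td a T)"

definition heat_flux ::
    "real \<Rightarrow> real \<Rightarrow> real \<Rightarrow> real \<Rightarrow> real \<Rightarrow> real \<Rightarrow> (real \<Rightarrow> real) \<Rightarrow> real"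
  where "heat_flux k l \<beta> \<beta>r Tinf Td a =
    - k * pi * (a 0)\<^sup>2 *
      vector_derivative (temperature l \<beta> \<beta>r Tinf Td a) (at 0 within {0..l})"

definition admissible :: "real \<Rightarrow> real \<Rightarrow> real \<Rightarrow> (real \<Rightarrow> real) set"
  where "admissible a0 l V0 =
    {a \<in> W1 l (Linf l). (AE x in lebesgue_on {0..l}. a0 \<le> a x) \<and>
       (LINT x|lebesgue_on {0..l}. (a x)\<^sup>2) \<le> V0}"

end

theory Submission imports Defs begin

text \<open>
  A narrow spike at the hot end makes the heat flux arbitrarily large. The flux through the
  inlet is the heat lost downstream, which includes the loss through the lateral surface. For a
  profile that falls from a large value \<open>A\<close> to \<open>a0\<close> within a short interval, the surface weight
  \<open>a * sqrt (1 + a'\<^sup>2) \<ge> a * \<bar>a'\<bar>\<close> has integral at least \<open>(A\<^sup>2 - a0\<^sup>2) / 2\<close>, however short the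
  interval is, whereas the volume of the spike tends to \<open>0\<close> with its width. The temperature
  cannot drop much along the spike, since the growing cross section \<open>a\<^sup>2\<close> carries the growing
  flux with a bounded temperature gradient. So the flux is at least of the order of \<open>A\<^sup>2\<close>
  (\<open>catenary_flux_bound\<close>, \<open>spike_heat_flux_ge\<close>), and it is unbounded on the admissible class
  (\<open>heat_flux_unbounded\<close>). An unbounded real functional has supremum infinity and no maximizer.

  The shape of the spike is a catenary, the generating curve of the minimal surface of
  revolution. For it \<open>a * sqrt (1 + a'\<^sup>2)\<close> is a multiple of \<open>a\<^sup>2\<close>, and the equation has solutions in
  terms of hyperbolic functions (\<open>catenary_solution\<close>); the rest of the profile is the constant
  \<open>a0\<close>, where the same is true (\<open>cylinder_solution\<close>). Existence is thus a computation.

  What remains is that the explicit function is \<^emph>\<open>the\<close> temperature, that is, uniqueness in the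
  class of weak solutions. The lemma of du Bois-Reymond (\<open>weak_deriv_AE_primitive\<close>) turns
  weak derivatives into integrals, so that a difference of two solutions is \<open>C\<^sup>1\<close> up to the boundary
  and its flux is a primitive of a nonnegative multiple of the difference. A maximum
  principle (\<open>maximum_principle\<close>) then makes the difference vanish.
\<close>

section \<open>Integration on the interval and the fundamental lemma of the calculus of variations\<close>

lemma integrable_leb_bounded:
  fixes f :: "real \<Rightarrow> real"
  assumes "f \<in> borel_measurable (leb l)" "\<And>x. x \<in> {0<..<l} \<Longrightarrow> \<bar>f x\<bar> \<le> C"
  shows "integrable (leb l) f"
proof (rule finite_measure.integrable_const_bound[where B=C])
  show "finite_measure (leb l)"
    by (rule finite_measure_lebesgue_on) simp
qed (use assms in auto)

lemma measurable_leb_continuous: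
  fixes c :: "real \<Rightarrow> real"
  assumes "continuous_on {0..l} c"
  shows "c \<in> borel_measurable (leb l)"
  by (rule continuous_imp_measurable_on_sets_lebesgue)
     (auto intro: continuous_on_subset[OF assms])

lemma continuous_bounded_ivl:
  fixes c :: "real \<Rightarrow> real"
  assumes "continuous_on {0..l} c"
  obtains B where "B > 0" "\<And>x. x \<in> {0..l} \<Longrightarrow> \<bar>c x\<bar> \<le> B"
proof -
  have "bounded (c ` {0..l})"
    using assms by (intro compact_imp_bounded compact_continuous_image) auto
  then show ?thesis
    using that unfolding bounded_pos by force
qed

lemma integrable_leb_mult_continuous:
  fixes f c :: "real \<Rightarrow> real"
  assumes f: "integrable (leb l) f" and c: "continuous_on {0..l} c"
  shows "integrable (leb l) (\<lambda>x. f x * c x)"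
proof -
  obtain B where B: "B > 0" "\<And>x. x \<in> {0..l} \<Longrightarrow> \<bar>c x\<bar> \<le> B"
    using continuous_bounded_ivl[OF c] by blast
  show ?thesis
  proof (rule Bochner_Integration.integrable_bound[where f="\<lambda>x. B * f x"])
    show "integrable (leb l) (\<lambda>x. B * f x)" using f by simp
    show "(\<lambda>x. f x * c x) \<in> borel_measurable (leb l)"
      using f measurable_leb_continuous[OF c] by simp
    show "AE x in leb l. norm (f x * c x) \<le> norm (B * f x)"
      using B by (auto intro!: AE_I2 simp: abs_mult mult.commute[of B] intro!: mult_left_mono)
  qed
qed

lemma integrable_leb_continuous:
  fixes c :: "real \<Rightarrow> real"
  assumes "continuous_on {0..l} c"
  shows "integrable (leb l) c"
  using integrable_leb_mult_continuous[OF _ assms, of "\<lambda>_. 1"]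
  by (simp add: integrable_leb_bounded[of _ _ 1])

lemma LINT_leb_eq_integral:
  assumes "integrable (leb l) (f :: real \<Rightarrow> real)"
  shows "(LINT x|leb l. f x) = integral {0..l} f"
  using lebesgue_integral_eq_integral[OF assms] by (simp add: integral_open_interval_real)

lemma integrable_leb_indicator:
  assumes f: "integrable (leb l) (f :: real \<Rightarrow> real)"
  shows "integrable (leb l) (\<lambda>x. f x * indicator {p<..<q} x)"
proof (rule Bochner_Integration.integrable_bound[OF f])
  have "indicator {p<..<q} \<in> borel_measurable (leb l)"
    by (rule measurable_restrict_space1) (auto intro!: borel_measurable_indicator)
  then show "(\<lambda>x. f x * indicator {p<..<q} x) \<in> borel_measurable (leb l)"
    using f by (intro borel_measurable_times) auto
qed (auto simp: indicator_def)

lemma LINT_leb_indicator: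
  assumes f: "integrable (leb l) (f :: real \<Rightarrow> real)" and "0 \<le> p" "q \<le> l"
  shows "(LINT x|leb l. f x * indicator {p<..<q} x) = integral {p..q} f"
proof -
  have "(LINT x|leb l. f x * indicator {p<..<q} x) =
      integral {0..l} (\<lambda>x. f x * indicator {p<..<q} x)"
    by (intro LINT_leb_eq_integral integrable_leb_indicator f)
  also have "\<dots> = integral {0..l} (\<lambda>x. if x \<in> {p<..<q} then f x else 0)"
    by (intro integral_cong) auto
  also have "\<dots> = integral ({0..l} \<inter> {p<..<q}) f"
    by (simp only: integral_restrict_Int Int_commute)
  also have "{0..l} \<inter> {p<..<q} = {p<..<q}" using assms by auto
  finally show ?thesis by (simp only: integral_open_interval_real)
qed

lemma integrable_on_if_leb:
  assumes "integrable (leb l) (f :: real \<Rightarrow> real)" "0 \<le> x" "x \<le> y" "y \<le> l"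
  shows "f integrable_on {x..y}"
proof -
  have "f integrable_on {0<..<l}"
    using assms by (simp add: integrable_on_lebesgue_on)
  then have "f integrable_on {0..l}"
    by (simp add: integrable_on_open_interval_real)
  then show ?thesis
    by (rule integrable_on_subinterval) (use assms in auto)
qed

lemma integral_cong_AE_leb:
  fixes f g :: "real \<Rightarrow> real"
  assumes "AE x in leb l. f x = g x" "0 \<le> x" "y \<le> l"
  shows "integral {x..y} f = integral {x..y} g"
proof -
  have "AE x in lebesgue. x \<in> {0<..<l} \<longrightarrow> f x = g x"
    using assms(1) by (simp add: AE_restrict_space_iff)
  then obtain N where "N \<in> null_sets lebesgue" "{x. \<not> (x \<in> {0<..<l} \<longrightarrow> f x = g x)} \<subseteq> N"
    unfolding eventually_ae_filter by auto
  then have "negligible N" by (simp add: negligible_iff_null_sets)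
  then have "negligible (N \<union> {0, l})"
    by (intro negligible_Un) auto
  moreover have "g z = f z" if "z \<in> {x..y} - (N \<union> {0, l})" for z
  proof -
    have "z \<in> {0<..<l}" "z \<notin> N"
      using that assms(2,3) by auto
    then show ?thesis
      using \<open>{x. \<not> (x \<in> {0<..<l} \<longrightarrow> f x = g x)} \<subseteq> N\<close> by auto
  qed
  ultimately show ?thesis
    by (rule integral_spike)
qed

lemma test_functionD:
  assumes "test_function l \<phi>"
  shows "(\<phi> has_real_derivative deriv \<phi> x) (at x)" "continuous_on S (deriv \<phi>)"
    "continuous_on S \<phi>" "\<phi> 0 = 0" "\<phi> l = 0"
proof -
  obtain D where D: "\<And>x. (\<phi> has_vector_derivative (D x)) (at x)" "continuous_on UNIV D"
    using assms unfolding test_function_def C1_differentiable_on_def by auto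
  have "(\<phi> has_real_derivative D x) (at x)" for x
    using D by (simp add: has_real_derivative_iff_has_vector_derivative)
  moreover from this have "deriv \<phi> = D"
    by (auto intro: DERIV_imp_deriv)
  ultimately show *: "(\<phi> has_real_derivative deriv \<phi> x) (at x)" for x
    by simp
  show "continuous_on S (deriv \<phi>)"
    using D \<open>deriv \<phi> = D\<close> by (auto intro: continuous_on_subset)
  show "continuous_on S \<phi>"
    by (meson * DERIV_continuous_on DERIV_subset subset_UNIV)
  show "\<phi> 0 = 0" "\<phi> l = 0"
    using assms unfolding test_function_def by force+
qed

lemma has_real_derivative_max0_square:
  "((\<lambda>t::real. (max 0 t)\<^sup>2) has_real_derivative 2 * max 0 x) (at x)"
proof -
  consider "x > 0" | "x < 0" | "x = 0" by linarith
  then show ?thesis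
  proof cases
    case 1
    have "((\<lambda>t::real. t\<^sup>2) has_real_derivative 2 * max 0 x) (at x)"
      using 1 by (auto intro!: derivative_eq_intros)
    then show ?thesis
      by (rule has_field_derivative_transform_within[where d=x]) (use 1 in \<open>auto simp: dist_real_def\<close>)
  next
    case 2
    have "((\<lambda>t::real. 0) has_real_derivative 2 * max 0 x) (at x)"
      using 2 by (auto intro!: derivative_eq_intros)
    then show ?thesis
      by (rule has_field_derivative_transform_within[where d="-x"]) (use 2 in \<open>auto simp: dist_real_def\<close>)
  next
    case 3
    have "((\<lambda>t::real. max 0 t) \<longlongrightarrow> max 0 0) (at 0)"
      by (intro tendsto_intros)
    moreover have "(\<lambda>y::real. ((max 0 y)\<^sup>2 - (max 0 0)\<^sup>2) / (y - 0)) = max 0"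
      by (auto simp: fun_eq_iff max_def power2_eq_square)
    ultimately have "((\<lambda>y. ((max 0 y)\<^sup>2 - (max 0 0)\<^sup>2) / (y - 0)) \<longlongrightarrow> 0) (at (0::real))"
      by simp
    then show ?thesis using 3 by (simp add: has_field_derivative_iff)
  qed
qed

text \<open>
  A test function has to be \<open>C\<^sup>1\<close>, so that a Heaviside step is approximated by a function of
  \<open>(max 0 t)\<^sup>2\<close>, which is \<open>C\<^sup>1\<close> across \<open>0\<close>. The approximation is exactly \<open>0\<close> for \<open>t \<le> 0\<close>, whence
  the product of two opposite steps is supported in a compact interval.
\<close>

definition step_approx :: "nat \<Rightarrow> real \<Rightarrow> real"
  where "step_approx n t = 1 - exp (- real n * (max 0 t)\<^sup>2)"

definition bump :: "real \<Rightarrow> real \<Rightarrow> nat \<Rightarrow> real \<Rightarrow> real"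
  where "bump p q n x = step_approx n (x - p) * step_approx n (q - x)"

lemma has_real_derivative_step_approx [derivative_intros]:
  assumes "(f has_real_derivative f') (at x within S)"
  shows "((\<lambda>x. step_approx n (f x)) has_real_derivative
    real n * (2 * max 0 (f x)) * exp (- real n * (max 0 (f x))\<^sup>2) * f') (at x within S)"
  unfolding step_approx_def
  by (rule derivative_eq_intros refl DERIV_chain2[OF has_real_derivative_max0_square assms] | simp)+

lemma test_function_bump:
  assumes "0 < p" "p < q" "q < l"
  shows "test_function l (bump p q n)"
  unfolding test_function_def
proof
  let ?s = "\<lambda>t. real n * (2 * max 0 t) * exp (- real n * (max 0 t)\<^sup>2)"
  let ?D = "\<lambda>x. ?s (x - p) * step_approx n (q - x) - ?s (q - x) * step_approx n (x - p)"
  have "(bump p q n has_real_derivative ?D x) (at x)" for x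
    unfolding bump_def[abs_def] by (rule derivative_eq_intros refl | simp)+
  moreover have "continuous_on UNIV ?D"
    unfolding step_approx_def by (intro continuous_intros)
  ultimately show "bump p q n C1_differentiable_on UNIV"
    unfolding C1_differentiable_on_def has_real_derivative_iff_has_vector_derivative
    by (intro exI[of _ ?D]) simp
  show "\<exists>K. compact K \<and> K \<subseteq> {0<..<l} \<and> (\<forall>x. x \<notin> K \<longrightarrow> bump p q n x = 0)"
    using assms by (intro exI[of _ "{p..q}"]) (auto simp: bump_def step_approx_def)
qed

lemma step_approx_bounds: "0 \<le> step_approx n t" "step_approx n t \<le> 1"
  by (auto simp: step_approx_def)

lemma step_approx_tendsto: "(\<lambda>n. step_approx n t) \<longlonglongrightarrow> indicator {0<..} t"
proof (cases "t > 0")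
  case True
  then have "exp (- (max 0 t)\<^sup>2) < 1" by simp
  then have "(\<lambda>n. 1 - exp (- (max 0 t)\<^sup>2) ^ n) \<longlonglongrightarrow> 1 - 0"
    by (intro tendsto_intros LIMSEQ_realpow_zero) auto
  with True show ?thesis
    by (simp add: step_approx_def exp_of_nat_mult[symmetric])
qed (simp add: step_approx_def)

lemma bump_tendsto: "(\<lambda>n. bump p q n x) \<longlonglongrightarrow> indicator {p<..<q} x"
proof -
  have "(\<lambda>n. bump p q n x) \<longlonglongrightarrow> indicator {0<..} (x - p) * indicator {0<..} (q - x)"
    unfolding bump_def by (intro tendsto_intros step_approx_tendsto)
  also have "indicator {0<..} (x - p) * indicator {0<..} (q - x) = (indicator {p<..<q} x :: real)"
    by (auto simp: indicator_def)
  finally show ?thesis .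
qed

text \<open>
  The bumps converge boundedly to the indicator of \<open>(p, q)\<close>, so \<open>f\<close> has integral \<open>0\<close> over every
  compact subinterval. The value of an integrable function at almost every point is the limit of
  its averages over intervals starting there, and these averages all vanish.
\<close>

lemma fundamental_lemma_variations:
  fixes f :: "real \<Rightarrow> real"
  assumes f: "integrable (leb l) f"
    and ortho: "\<And>\<psi>. test_function l \<psi> \<Longrightarrow> (LINT x|leb l. f x * \<psi> x) = 0"
  shows "AE x in leb l. f x = 0"
proof -
  have zero: "integral {p..q} f = 0" if pq: "0 < p" "p < q" "q < l" for p q
  proof -
    have fb: "integrable (leb l) (\<lambda>x. f x * bump p q n x)" for n
      by (intro integrable_leb_mult_continuous f test_functionD(3)[OF test_function_bump[OF pq]])
    have meas: "(\<lambda>x. f x * indicator {p<..<q} x) \<in> borel_measurable (leb l)"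
      by (intro borel_measurable_integrable integrable_leb_indicator f)
    have "(\<lambda>n. LINT x|leb l. f x * bump p q n x) \<longlonglongrightarrow> (LINT x|leb l. f x * indicator {p<..<q} x)"
    proof (rule integral_dominated_convergence[where w="\<lambda>x. norm (f x)"])
      show "AE x in leb l. norm (f x * bump p q n x) \<le> norm (f x)" for n
        unfolding bump_def using step_approx_bounds
        by (auto intro!: AE_I2 mult_left_le mult_le_one simp: abs_mult)
      show "AE x in leb l. (\<lambda>n. f x * bump p q n x) \<longlonglongrightarrow> f x * indicator {p<..<q} x"
        by (intro AE_I2 tendsto_intros bump_tendsto)
    qed (use f fb meas in auto)
    then have 0: "(LINT x|leb l. f x * indicator {p<..<q} x) = 0"
      using ortho[OF test_function_bump[OF pq]] by (simp add: LIMSEQ_const_iff)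
    then show ?thesis
      using pq f by (simp add: LINT_leb_indicator)
  qed
  let ?F = "\<lambda>x. if x \<in> {0<..<l} then f x else 0"
  have "?F integrable_on UNIV"
    unfolding integrable_restrict_UNIV using f by (simp add: integrable_on_lebesgue_on)
  then have "?F integrable_on cbox a b" for a b
    by (rule integrable_on_subcbox) auto
  then obtain N where N: "negligible N" and
    dens: "\<And>x e. \<lbrakk>x \<notin> N; 0 < e\<rbrakk> \<Longrightarrow> \<exists>d>0. \<forall>h. 0 < h \<and> h < d \<longrightarrow>
       norm (integral (cbox x (x + h *\<^sub>R One)) ?F /\<^sub>R h ^ DIM(real) - ?F x) < e"
    using integrable_ccontinuous_explicit[of ?F] by blast
  have "f x = 0" if x: "x \<in> {0<..<l}" "x \<notin> N" for x
  proof (rule ccontr)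
    assume "f x \<noteq> 0"
    then obtain d where d: "d > 0" "\<And>h. 0 < h \<Longrightarrow> h < d \<Longrightarrow>
        norm (integral {x..x + h} ?F / h - f x) < \<bar>f x\<bar>"
      using dens[OF x(2), of "\<bar>f x\<bar>"] x(1) by (auto simp: divide_inverse mult.commute)
    define h where "h = min d (l - x) / 2"
    have h: "0 < h" "h < d" "x + h < l"
      using d x by (auto simp: h_def min_def field_simps)
    have "integral {x..x + h} ?F = integral {x..x + h} f"
      using x h by (intro integral_cong) auto
    then show False
      using d(2)[OF h(1,2)] zero[of x "x + h"] x h by simp
  qed
  then have "AE x in lebesgue. x \<in> {0<..<l} \<longrightarrow> f x = 0"
    using N by (intro AE_I'[of N]) (auto simp: negligible_iff_null_sets)
  then show ?thesis
    by (simp add: AE_restrict_space_iff)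
qed

section \<open>Weak derivatives and their primitives\<close>

text \<open>
  An open set of measure zero is empty; the endpoints follow by density.
\<close>

lemma AE_leb_eq_imp_eq:
  fixes f g :: "real \<Rightarrow> real"
  assumes "continuous_on {0..l} f" "continuous_on {0..l} g" "0 < l"
    and ae: "AE x in leb l. f x = g x" and x: "x \<in> {0..l}"
  shows "f x = g x"
proof -
  let ?U = "{x \<in> {0<..<l}. f x - g x \<in> - {0}}"
  have cont: "continuous_on {0<..<l} (\<lambda>x. f x - g x)"
    by (rule continuous_on_subset[of "{0..l}"]) (auto intro: continuous_intros assms)
  have "open ?U"
    using continuous_open_preimage[OF cont open_greaterThanLessThan, of "- {0}"]
    by (simp add: vimage_def Int_def open_Compl)
  moreover have "negligible ?U"
  proof -
    have "AE x in lebesgue. x \<notin> ?U"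
      using ae by (auto simp: AE_restrict_space_iff elim!: eventually_mono)
    moreover have "?U \<in> sets lebesgue"
      using \<open>open ?U\<close> by (simp add: borel_open)
    ultimately have "?U \<in> null_sets lebesgue"
      using AE_iff_null_sets[of ?U lebesgue] by blast
    then show ?thesis
      by (simp add: negligible_iff_null_sets)
  qed
  ultimately have "?U = {}"
    using open_not_negligible by blast
  then have "f x - g x = 0" if "x \<in> {0<..<l}" for x
    using that by auto
  moreover have "closure {0<..<l} = {0..l}"
    using \<open>0 < l\<close> by simp
  ultimately have "f x - g x = 0"
    using continuous_constant_on_closure[of "{0<..<l}" "\<lambda>x. f x - g x" 0 x] assms
    by (auto intro: continuous_intros)
  then show ?thesis by simp
qed

lemma continuous_on_primitive:
  assumes "integrable (leb l) (g :: real \<Rightarrow> real)"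
  shows "continuous_on {0..l} (\<lambda>x. integral {0..x} g)"
proof (cases "0 \<le> l")
  case True
  then show ?thesis
    using integrable_on_if_leb[OF assms, of 0 l] by (intro indefinite_integral_continuous_1) auto
qed auto

text \<open>
  Fubini on the triangle \<open>t < x\<close>: integrating \<open>g t * deriv \<phi> x\<close> first in \<open>x\<close> gives \<open>- g t * \<phi> t\<close>
  because \<open>\<phi>\<close> vanishes at \<open>l\<close>, integrating it first in \<open>t\<close> gives the primitive of \<open>g\<close> times
  \<open>deriv \<phi>\<close>.
\<close>

lemma weak_deriv_primitive:
  assumes g: "integrable (leb l) g" and \<phi>: "test_function l \<phi>"
  shows "(LINT x|leb l. integral {0..x} g * deriv \<phi> x) = - (LINT x|leb l. g x * \<phi> x)"
proof -
  interpret L: finite_measure "leb l"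
    by (rule finite_measure_lebesgue_on) simp
  interpret LL: pair_sigma_finite "leb l" "leb l" ..
  note \<phi>' = test_functionD(2)[OF \<phi>]
  define f where "f = (\<lambda>x t. g t * (if t < x then deriv \<phi> x else 0))"
  have id: "(\<lambda>x. x) \<in> borel_measurable (leb l)"
    by (rule measurable_leb_continuous) (rule continuous_on_id)
  have [measurable]: "(\<lambda>w. fst w) \<in> borel_measurable (leb l \<Otimes>\<^sub>M leb l)"
    "(\<lambda>w. snd w) \<in> borel_measurable (leb l \<Otimes>\<^sub>M leb l)"
    "(\<lambda>w. g (snd w)) \<in> borel_measurable (leb l \<Otimes>\<^sub>M leb l)"
    "(\<lambda>w. deriv \<phi> (fst w)) \<in> borel_measurable (leb l \<Otimes>\<^sub>M leb l)"
    using measurable_compose[OF measurable_fst id] measurable_compose[OF measurable_snd id]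
      measurable_compose[OF measurable_snd borel_measurable_integrable[OF g]]
      measurable_compose[OF measurable_fst measurable_leb_continuous[OF \<phi>']] by auto
  have meas: "case_prod f \<in> borel_measurable (leb l \<Otimes>\<^sub>M leb l)"
    unfolding f_def case_prod_beta' by measurable
  obtain B where B: "B > 0" "\<And>x. x \<in> {0..l} \<Longrightarrow> \<bar>deriv \<phi> x\<bar> \<le> B"
    using continuous_bounded_ivl[OF \<phi>'] by blast
  have f_eq: "f x t = deriv \<phi> x * (g t * indicator {0<..<x} t)" if "t \<in> space (leb l)" for x t
    using that by (auto simp: f_def indicator_def)
  have f_eq2: "f x t = g t * (deriv \<phi> x * indicator {t<..<l} x)" if "x \<in> space (leb l)" for x t
    using that by (auto simp: f_def indicator_def)
  have int_t: "integrable (leb l) (\<lambda>t. f x t)" for x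
    using integrable_leb_indicator[OF g]
    by (subst Bochner_Integration.integrable_cong[OF refl f_eq]) auto
  have "integrable (leb l \<Otimes>\<^sub>M leb l) (case_prod f)"
  proof (rule LL.Fubini_integrable[OF meas])
    have "integrable (leb l) (\<lambda>x. LINT t|leb l. norm (f x t))"
    proof (rule L.integrable_const_bound[where B="LINT t|leb l. B * norm (g t)"])
      show "AE x in leb l. norm (LINT t|leb l. norm (f x t)) \<le> (LINT t|leb l. B * norm (g t))"
      proof (rule AE_I2)
        fix x assume "x \<in> space (leb l)"
        then have "x \<in> {0..l}" by auto
        have "norm (LINT t|leb l. norm (f x t)) = (LINT t|leb l. norm (f x t))"
          by (simp add: integral_nonneg_AE)
        also have "\<dots> \<le> (LINT t|leb l. B * norm (g t))"
        proof (rule integral_mono)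
          show "norm (f x t) \<le> B * norm (g t)" for t
            using B(1) B(2)[OF \<open>x \<in> {0..l}\<close>]
            by (auto simp: f_def abs_mult mult.commute[of B] intro!: mult_left_mono)
        qed (use g int_t in auto)
        finally show "norm (LINT t|leb l. norm (f x t)) \<le> (LINT t|leb l. B * norm (g t))" .
      qed
      have "(\<lambda>w. norm (case_prod f w)) \<in> borel_measurable (leb l \<Otimes>\<^sub>M leb l)"
        using meas by measurable
      then have "case_prod (\<lambda>x t. norm (f x t)) \<in> borel_measurable (leb l \<Otimes>\<^sub>M leb l)"
        by (simp add: case_prod_beta')
      then show "(\<lambda>x. LINT t|leb l. norm (f x t)) \<in> borel_measurable (leb l)"
        by (rule L.borel_measurable_lebesgue_integral)
    qed
    then show "integrable (leb l) (\<lambda>x. LINT t|leb l. norm (case (x, t) of (x, t) \<Rightarrow> f x t))"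
      by simp
  qed (use int_t in auto)
  from LL.Fubini_integral[OF this]
  have swap: "(LINT t|leb l. LINT x|leb l. f x t) = (LINT x|leb l. LINT t|leb l. f x t)" .
  have "(LINT x|leb l. f x t) = - (g t * \<phi> t)" if "t \<in> space (leb l)" for t
  proof -
    have t: "0 \<le> t" "t \<le> l" using that by auto
    have "(LINT x|leb l. f x t) = g t * (LINT x|leb l. deriv \<phi> x * indicator {t<..<l} x)"
    proof -
      have "(LINT x|leb l. f x t) = (LINT x|leb l. g t * (deriv \<phi> x * indicator {t<..<l} x))"
        by (intro Bochner_Integration.integral_cong f_eq2 refl)
      then show ?thesis by simp
    qed
    also have "(LINT x|leb l. deriv \<phi> x * indicator {t<..<l} x) = integral {t..l} (deriv \<phi>)"
      by (intro LINT_leb_indicator integrable_leb_continuous \<phi>' t) simp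
    also have "\<dots> = \<phi> l - \<phi> t"
      using t test_functionD(1)[OF \<phi>]
      by (intro integral_unique fundamental_theorem_of_calculus)
         (auto simp: has_real_derivative_iff_has_vector_derivative[symmetric]
               intro: DERIV_subset)
    finally show ?thesis
      using test_functionD(5)[OF \<phi>] by simp
  qed
  then have "(LINT t|leb l. LINT x|leb l. f x t) = (LINT t|leb l. - (g t * \<phi> t))"
    by (intro Bochner_Integration.integral_cong) auto
  moreover have "(LINT t|leb l. f x t) = integral {0..x} g * deriv \<phi> x"
    if "x \<in> space (leb l)" for x
  proof -
    have x: "x \<le> l" using that by auto
    have "(LINT t|leb l. f x t) = deriv \<phi> x * (LINT t|leb l. g t * indicator {0<..<x} t)"
    proof -
      have "(LINT t|leb l. f x t) = (LINT t|leb l. deriv \<phi> x * (g t * indicator {0<..<x} t))"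
        by (intro Bochner_Integration.integral_cong f_eq refl)
      then show ?thesis by simp
    qed
    also have "\<dots> = deriv \<phi> x * integral {0..x} g"
      using LINT_leb_indicator[OF g, of 0 x] x by simp
    finally show ?thesis by simp
  qed
  then have "(LINT x|leb l. LINT t|leb l. f x t) = (LINT x|leb l. integral {0..x} g * deriv \<phi> x)"
    by (intro Bochner_Integration.integral_cong) auto
  ultimately show ?thesis
    using swap by simp
qed

lemma test_function_lincomb:
  assumes "test_function l \<phi>" "test_function l \<psi>"
  shows "test_function l (\<lambda>x. \<phi> x - c * \<psi> x)"
proof -
  obtain K L where "compact K" "compact L" "K \<subseteq> {0<..<l}" "L \<subseteq> {0<..<l}"
    "\<And>x. x \<notin> K \<Longrightarrow> \<phi> x = 0" "\<And>x. x \<notin> L \<Longrightarrow> \<psi> x = 0"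
    using assms unfolding test_function_def by metis
  then show ?thesis
    using assms unfolding test_function_def
    by (intro conjI C1_differentiable_on_diff C1_differentiable_on_mult C1_differentiable_on_const)
       (auto intro!: exI[of _ "K \<union> L"])
qed

text \<open>
  The vanishing mean is what makes the primitive return to \<open>0\<close> to the right of the support.
\<close>

lemma test_function_primitive:
  assumes \<rho>: "test_function l \<rho>" and mean: "(LINT x|leb l. \<rho> x) = 0" and "0 < l"
  obtains \<Phi> where "test_function l \<Phi>" "deriv \<Phi> = \<rho>"
proof -
  obtain K where K: "compact K" "K \<subseteq> {0<..<l}" "\<And>x. x \<notin> K \<Longrightarrow> \<rho> x = 0"
    using \<rho> unfolding test_function_def by auto
  obtain p q where pq: "0 < p" "q < l" "p \<le> q" "K \<subseteq> {p..q}"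
  proof (cases "K = {}")
    case True
    show ?thesis by (rule that[of "l/2" "l/2"]) (use True \<open>0 < l\<close> in auto)
  next
    case False
    obtain p q where "p \<in> K" "q \<in> K" "\<And>x. x \<in> K \<Longrightarrow> p \<le> x" "\<And>x. x \<in> K \<Longrightarrow> x \<le> q"
      using compact_attains_inf[OF K(1) False] compact_attains_sup[OF K(1) False] by metis
    then show ?thesis
      using K(2) that[of p q] by force
  qed
  have \<rho>0: "\<rho> x = 0" if "x < p \<or> q < x" for x
    using that pq K(3) by force
  note cont = test_functionD(3)[OF \<rho>]
  have int: "\<rho> integrable_on {x..y}" for x y
    by (intro integrable_continuous_real cont)
  define \<Phi> where "\<Phi> y = integral {0..y} \<rho>" for y
  have base: "\<Phi> y = integral {b..y} \<rho>" if "b \<le> 0" for b y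
  proof (cases "0 \<le> y")
    case True
    have "integral {b..0} \<rho> = 0"
      using \<rho>0 pq by (intro integral_unique has_integral_is_0) auto
    then show ?thesis
      using Henstock_Kurzweil_Integration.integral_combine[OF that True int] by (simp add: \<Phi>_def)
  next
    case False
    have "integral {b..y} \<rho> = 0"
      using \<rho>0 pq False by (intro integral_unique has_integral_is_0) auto
    then show ?thesis using False by (simp add: \<Phi>_def)
  qed
  \<comment> \<open>The base point of the primitive is moved to the left of both 0 and x, to make x an interior
    point of the interval on which the integral is differentiated.\<close>
  have deriv: "(\<Phi> has_real_derivative \<rho> x) (at x)" for x
  proof -
    define b where "b = min x 0 - 1"
    have "((\<lambda>y. integral {b..y} \<rho>) has_real_derivative \<rho> x) (at x within {b..x+1})"
      by (intro integral_has_real_derivative cont) (auto simp: b_def)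
    moreover have "(\<lambda>y. integral {b..y} \<rho>) = \<Phi>"
      using base[of b] by (auto simp: b_def)
    moreover have "at x within {b..x+1} = at x"
      by (rule at_within_interior) (auto simp: b_def)
    ultimately show ?thesis by simp
  qed
  have "\<Phi> y = 0" if "y \<notin> {p..q}" for y
  proof (cases "y < p")
    case True
    then show ?thesis
      unfolding \<Phi>_def using \<rho>0 by (intro integral_unique has_integral_is_0) auto
  next
    case False
    with that pq have y: "q < y" "0 \<le> y" by auto
    have "integral {0..q} \<rho> + integral {q..z} \<rho> = integral {0..z} \<rho>" if "q \<le> z" for z
      using that pq by (intro Henstock_Kurzweil_Integration.integral_combine int) auto
    moreover have "integral {q..z} \<rho> = 0" for z
    proof -
      have "integral {q..z} (\<lambda>_. 0) = integral {q..z} \<rho>"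
        using \<rho>0 by (intro integral_spike[of "{q}"]) auto
      then show ?thesis by simp
    qed
    moreover have "integral {0..l} \<rho> = 0"
      using mean LINT_leb_eq_integral[OF integrable_leb_continuous[OF cont]] by simp
    ultimately show ?thesis
      unfolding \<Phi>_def using y pq by (metis (no_types) add.right_neutral less_imp_le)
  qed
  moreover have "\<Phi> C1_differentiable_on UNIV"
    unfolding C1_differentiable_on_def
    using deriv cont by (auto simp: has_real_derivative_iff_has_vector_derivative)
  ultimately have "test_function l \<Phi>"
    unfolding test_function_def using pq by (auto intro!: exI[of _ "{p..q}"])
  moreover have "deriv \<Phi> = \<rho>"
    using deriv by (auto intro: DERIV_imp_deriv)
  ultimately show ?thesis ..
qed

lemma has_weak_derivD:
  assumes "has_weak_deriv l u g"
  shows "integrable (leb l) u" "integrable (leb l) g"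
    "test_function l \<phi> \<Longrightarrow> (LINT x|leb l. u x * deriv \<phi> x) = - (LINT x|leb l. g x * \<phi> x)"
  using assms unfolding has_weak_deriv_def by auto

lemma has_weak_deriv_diff:
  assumes "has_weak_deriv l u g" "has_weak_deriv l v h"
  shows "has_weak_deriv l (\<lambda>x. u x - v x) (\<lambda>x. g x - h x)"
  unfolding has_weak_deriv_def
proof (intro conjI allI impI)
  fix \<phi> assume \<phi>: "test_function l \<phi>"
  note 1 = has_weak_derivD[OF assms(1)] and 2 = has_weak_derivD[OF assms(2)]
  have "(LINT x|leb l. (u x - v x) * deriv \<phi> x) =
      (LINT x|leb l. u x * deriv \<phi> x) - (LINT x|leb l. v x * deriv \<phi> x)"
    unfolding left_diff_distrib
    by (intro Bochner_Integration.integral_diff integrable_leb_mult_continuous 1 2 test_functionD[OF \<phi>])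
  moreover have "(LINT x|leb l. (g x - h x) * \<phi> x) =
      (LINT x|leb l. g x * \<phi> x) - (LINT x|leb l. h x * \<phi> x)"
    unfolding left_diff_distrib
    by (intro Bochner_Integration.integral_diff integrable_leb_mult_continuous 1 2 test_functionD[OF \<phi>])
  ultimately show "(LINT x|leb l. (u x - v x) * deriv \<phi> x) = - (LINT x|leb l. (g x - h x) * \<phi> x)"
    using 1(3)[OF \<phi>] 2(3)[OF \<phi>] by simp
qed (use assms in \<open>auto dest: has_weak_derivD\<close>)

text \<open>
  The lemma of du Bois-Reymond. Subtracting the primitive of \<open>h\<close> leaves a function \<open>G\<close> orthogonal
  to all derivatives of test functions. With a fixed test function \<open>\<eta>\<close> of nonzero mean, every test
  function is the sum of a multiple of \<open>\<eta>\<close> and of such a derivative; so \<open>G\<close> minus its \<open>\<eta>\<close>-average is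
  orthogonal to all test functions.
\<close>

lemma weak_deriv_AE_primitive:
  assumes wd: "has_weak_deriv l f h" and "0 < l"
  obtains k where "AE x in leb l. f x = k + integral {0..x} h"
proof -
  note f = has_weak_derivD(1)[OF wd] and h = has_weak_derivD(2)[OF wd]
  define G where "G x = f x - integral {0..x} h" for x
  have H: "integrable (leb l) (\<lambda>x. integral {0..x} h)"
    by (intro integrable_leb_continuous continuous_on_primitive h)
  have G: "integrable (leb l) G"
    unfolding G_def using f H by auto
  have G_mult: "integrable (leb l) (\<lambda>x. G x * \<phi> x)" if "test_function l \<phi>" for \<phi>
    by (intro integrable_leb_mult_continuous G test_functionD[OF that])
  have G0: "(LINT x|leb l. G x * deriv \<phi> x) = 0" if \<phi>: "test_function l \<phi>" for \<phi>
  proof -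
    have "(LINT x|leb l. G x * deriv \<phi> x) =
      (LINT x|leb l. f x * deriv \<phi> x) - (LINT x|leb l. integral {0..x} h * deriv \<phi> x)"
      unfolding left_diff_distrib G_def
      by (intro Bochner_Integration.integral_diff integrable_leb_mult_continuous f H test_functionD[OF \<phi>])
    then show ?thesis
      using has_weak_derivD(3)[OF wd \<phi>] weak_deriv_primitive[OF h \<phi>] by simp
  qed
  \<comment> \<open>A test function with nonzero mean exists, since otherwise the fundamental lemma would make
    the constant 1 vanish almost everywhere.\<close>
  have "\<not> (AE x in leb l. (1::real) = 0)"
    using \<open>0 < l\<close> ae_filter_eq_bot_iff[of "leb l"]
    by (simp add: trivial_limit_def emeasure_restrict_space)
  then obtain \<eta> where \<eta>: "test_function l \<eta>" "(LINT x|leb l. \<eta> x) \<noteq> 0"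
    using fundamental_lemma_variations[OF integrable_leb_continuous[OF continuous_on_const], of l 1]
    by (simp only: mult_1_left) blast
  define k where "k = (LINT x|leb l. G x * \<eta> x) / (LINT x|leb l. \<eta> x)"
  have "(LINT x|leb l. (G x - k) * \<psi> x) = 0" if \<psi>: "test_function l \<psi>" for \<psi>
  proof -
    note int = integrable_leb_continuous[OF test_functionD(3)]
    define c where "c = (LINT x|leb l. \<psi> x) / (LINT x|leb l. \<eta> x)"
    have "(LINT x|leb l. \<psi> x - c * \<eta> x) = (LINT x|leb l. \<psi> x) - c * (LINT x|leb l. \<eta> x)"
      using int[OF \<psi>] int[OF \<eta>(1)] by simp
    also have "\<dots> = 0" using \<eta>(2) by (simp add: c_def)
    finally obtain \<Phi> where "test_function l \<Phi>" "deriv \<Phi> = (\<lambda>x. \<psi> x - c * \<eta> x)"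
      using test_function_primitive[OF test_function_lincomb[OF \<psi> \<eta>(1)]] \<open>0 < l\<close> by metis
    then have "(LINT x|leb l. G x * \<psi> x - c * (G x * \<eta> x)) = 0"
      using G0[of \<Phi>] by (simp add: algebra_simps)
    then have "(LINT x|leb l. G x * \<psi> x) = c * (LINT x|leb l. G x * \<eta> x)"
      using G_mult[OF \<psi>] G_mult[OF \<eta>(1)] by simp
    also have "\<dots> = k * (LINT x|leb l. \<psi> x)"
      by (simp add: c_def k_def)
    finally show ?thesis
      using G_mult[OF \<psi>] int[OF \<psi>] by (simp add: left_diff_distrib)
  qed
  then have "AE x in leb l. G x - k = 0"
    by (intro fundamental_lemma_variations Bochner_Integration.integrable_diff G
        integrable_leb_continuous continuous_on_const)
  then have "AE x in leb l. f x = k + integral {0..x} h"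
    by eventually_elim (simp add: G_def)
  then show ?thesis ..
qed

lemma weak_deriv_continuous_eq_primitive:
  assumes wd: "has_weak_deriv l f h" and "0 < l" "continuous_on {0..l} f" "x \<in> {0..l}"
  shows "f x = f 0 + integral {0..x} h"
proof -
  obtain k where k: "AE x in leb l. f x = k + integral {0..x} h"
    using weak_deriv_AE_primitive[OF wd \<open>0 < l\<close>] by blast
  have *: "f x = k + integral {0..x} h" if "x \<in> {0..l}" for x
    by (rule AE_leb_eq_imp_eq[OF assms(3) _ \<open>0 < l\<close> k that])
       (intro continuous_intros continuous_on_primitive has_weak_derivD(2)[OF wd])
  show ?thesis
    using *[OF \<open>x \<in> {0..l}\<close>] *[of 0] \<open>0 < l\<close> by simp
qed

lemma weak_deriv_unique:
  assumes "has_weak_deriv l u g" "has_weak_deriv l u h"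
  shows "AE x in leb l. g x = h x"
proof -
  note d = has_weak_derivD[OF has_weak_deriv_diff[OF assms]]
  have "AE x in leb l. g x - h x = 0"
    by (rule fundamental_lemma_variations[OF d(2)]) (use d(3) in auto)
  then show ?thesis by eventually_elim simp
qed

section \<open>Uniqueness of the temperature and the heat flux of a classical solution\<close>

lemma has_weak_deriv_cong:
  assumes "has_weak_deriv l u g" "\<And>x. x \<in> {0<..<l} \<Longrightarrow> v x = u x" "\<And>x. x \<in> {0<..<l} \<Longrightarrow> h x = g x"
  shows "has_weak_deriv l v h"
proof -
  have "integrable (leb l) v = integrable (leb l) u" "integrable (leb l) h = integrable (leb l) g"
    by (intro Bochner_Integration.integrable_cong refl; use assms(2,3) in simp)+
  moreover have "(LINT x|leb l. v x * deriv \<phi> x) = (LINT x|leb l. u x * deriv \<phi> x)"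
    "(LINT x|leb l. h x * \<phi> x) = (LINT x|leb l. g x * \<phi> x)" for \<phi>
    by (intro Bochner_Integration.integral_cong refl; use assms(2,3) in simp)+
  ultimately show ?thesis
    using assms(1) by (simp add: has_weak_deriv_def)
qed

text \<open>
  The finitely many exceptional points \<open>S\<close> allow for the kink of the profile used below.
\<close>

lemma has_weak_deriv_classical:
  fixes f g :: "real \<Rightarrow> real"
  assumes "0 < l" "finite S" and f: "continuous_on {0..l} f"
    and deriv: "\<And>x. x \<in> {0<..<l} - S \<Longrightarrow> (f has_real_derivative g x) (at x)"
    and g: "g \<in> borel_measurable (leb l)" "\<And>x. x \<in> {0<..<l} \<Longrightarrow> \<bar>g x\<bar> \<le> C"
  shows "has_weak_deriv l f g"
  unfolding has_weak_deriv_def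
proof (intro conjI allI impI)
  show f': "integrable (leb l) f" and g': "integrable (leb l) g"
    using integrable_leb_continuous[OF f] integrable_leb_bounded[OF g] by auto
  fix \<phi> assume \<phi>: "test_function l \<phi>"
  note \<phi>s = test_functionD[OF \<phi>]
  have 1: "integrable (leb l) (\<lambda>x. f x * deriv \<phi> x)" and 2: "integrable (leb l) (\<lambda>x. g x * \<phi> x)"
    by (intro integrable_leb_mult_continuous f' g' \<phi>s)+
  have "((\<lambda>x. f x * deriv \<phi> x + g x * \<phi> x) has_integral f l * \<phi> l - f 0 * \<phi> 0) {0..l}"
  proof (rule fundamental_theorem_of_calculus_interior_strong[OF \<open>finite S\<close>])
    show "continuous_on {0..l} (\<lambda>x. f x * \<phi> x)"
      by (intro continuous_intros f \<phi>s)
    show "((\<lambda>x. f x * \<phi> x) has_vector_derivative f x * deriv \<phi> x + g x * \<phi> x) (at x)"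
      if "x \<in> {0<..<l} - S" for x
      using DERIV_mult[OF deriv[OF that] \<phi>s(1)]
      by (simp add: has_real_derivative_iff_has_vector_derivative algebra_simps)
  qed (use \<open>0 < l\<close> in auto)
  then have "integral {0..l} (\<lambda>x. f x * deriv \<phi> x + g x * \<phi> x) = 0"
    using \<phi>s(4,5) by (simp add: integral_unique)
  then have "(LINT x|leb l. f x * deriv \<phi> x + g x * \<phi> x) = 0"
    using LINT_leb_eq_integral[OF Bochner_Integration.integrable_add[OF 1 2]] by simp
  then show "(LINT x|leb l. f x * deriv \<phi> x) = - (LINT x|leb l. g x * \<phi> x)"
    using Bochner_Integration.integral_add[OF 1 2] by simp
qed

text \<open>
  This gives one-sided derivatives at the two endpoints, where the boundary condition and the heat
  flux are read off.
\<close>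

lemma has_real_derivative_if_weak_deriv:
  assumes wd: "has_weak_deriv l f h" and "0 < l" and f: "continuous_on {0..l} f"
    and D: "continuous_on {0..l} D" "AE x in leb l. h x = D x" and x: "x \<in> {0..l}"
  shows "(f has_real_derivative D x) (at x within {0..l})"
proof -
  have "f y = f 0 + integral {0..y} D" if "y \<in> {0..l}" for y
    using weak_deriv_continuous_eq_primitive[OF wd \<open>0 < l\<close> f that]
      integral_cong_AE_leb[OF D(2), of 0 y] that by simp
  moreover have "((\<lambda>y. f 0 + integral {0..y} D) has_real_derivative D x) (at x within {0..l})"
    using DERIV_add[OF DERIV_const integral_has_real_derivative[OF D(1) x]] by simp
  ultimately show ?thesis
    using has_field_derivative_transform_within[of "\<lambda>y. f 0 + integral {0..y} D" "D x" x "{0..l}" 1 f] x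
    by (metis zero_less_one)
qed

text \<open>
  Here \<open>P\<close> is the flux \<open>b w'\<close>, and it increases wherever \<open>w\<close> is positive. Suppose that \<open>w\<close> has a
  positive maximum at \<open>m\<close>. On the way up from the last point \<open>z\<close> before \<open>m\<close> where \<open>w\<close> is not
  positive, the mean value theorem gives a point with positive flux; the flux stays positive up to
  \<open>m\<close>. But it is not positive at \<open>m\<close>: \<open>w'\<close> vanishes there if \<open>m < l\<close>, and if \<open>m = l\<close> this is the
  hypothesis at the right end. The equation enters only through the monotonicity of \<open>P\<close>, which
  covers coefficients that are merely measurable.
\<close>

lemma maximum_principle:
  fixes w P b :: "real \<Rightarrow> real"
  assumes "0 < l"
    and deriv: "\<And>x. x \<in> {0..l} \<Longrightarrow> (w has_real_derivative P x / b x) (at x within {0..l})"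
    and b: "\<And>x. x \<in> {0..l} \<Longrightarrow> b x > 0"
    and mono: "\<And>x y. 0 \<le> x \<Longrightarrow> x \<le> y \<Longrightarrow> y \<le> l \<Longrightarrow> (\<And>z. z \<in> {x..y} \<Longrightarrow> 0 < w z) \<Longrightarrow> P x \<le> P y"
    and w0: "w 0 \<le> 0" and wl: "w l > 0 \<Longrightarrow> P l \<le> 0"
    and x: "x \<in> {0..l}"
  shows "w x \<le> 0"
proof (rule ccontr)
  assume "\<not> w x \<le> 0"
  have cont: "continuous_on {0..l} w"
    using deriv by (rule DERIV_continuous_on)
  then obtain m where m: "m \<in> {0..l}" "\<And>y. y \<in> {0..l} \<Longrightarrow> w y \<le> w m"
    using continuous_attains_sup[of "{0..l}" w] \<open>0 < l\<close> by auto
  have wm: "w m > 0"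
    using m(2)[OF x] \<open>\<not> w x \<le> 0\<close> by simp
  then have "m \<noteq> 0" using w0 by auto
  have Pm: "P m \<le> 0"
  proof (cases "m = l")
    case False
    with m \<open>m \<noteq> 0\<close> have int: "m \<in> {0<..<l}" by auto
    then have "at m within {0..l} = at m"
      by (intro at_within_interior) auto
    then have "(w has_real_derivative P m / b m) (at m)"
      using deriv[OF m(1)] by simp
    then have "P m / b m = 0"
      by (rule DERIV_local_max[where d="min m (l - m)"]) (use int m(2) in \<open>auto simp: abs_if split: if_splits\<close>)
    then show ?thesis using b[OF m(1)] by simp
  qed (use wl wm in auto)
  let ?Z = "{0..m} \<inter> w -` {..0}"
  have cont_m: "continuous_on {0..m} w"
    by (rule continuous_on_subset[OF cont]) (use m in auto)
  have "compact ?Z"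
  proof -
    have "closed ?Z"
      using cont_m by (intro continuous_closed_preimage) auto
    moreover have "bounded ?Z"
      by (rule bounded_subset[of "{0..m}"]) auto
    ultimately show ?thesis by (simp add: compact_eq_bounded_closed)
  qed
  moreover have "0 \<in> ?Z" using w0 m by auto
  ultimately obtain z where z: "z \<in> ?Z" "\<And>y. y \<in> ?Z \<Longrightarrow> y \<le> z"
    using compact_attains_sup[of ?Z] by blast
  have pos: "w y > 0" if "z < y" "y \<le> m" for y
    using z(2)[of y] z(1) that by force
  have "z < m" using z(1) wm by (cases "z = m") auto
  have "(w has_derivative (*) (P y / b y)) (at y within {z..m})" if "z \<le> y" "y \<le> m" for y
  proof -
    have "(w has_real_derivative P y / b y) (at y within {z..m})"
      by (rule DERIV_subset[OF deriv]) (use that z m in auto)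
    then show ?thesis
      by (simp add: has_field_derivative_def)
  qed
  from mvt_simple[OF \<open>z < m\<close> this]
  obtain \<xi> where \<xi>: "z < \<xi>" "\<xi> < m" "w m - w z = P \<xi> / b \<xi> * (m - z)"
    by auto
  have "0 < P \<xi> / b \<xi> * (m - z)"
    using \<xi>(3) z(1) wm by simp
  moreover have "b \<xi> > 0" using b[of \<xi>] \<xi> z m by simp
  ultimately have "P \<xi> > 0"
    using \<open>z < m\<close> by (simp add: zero_less_mult_iff zero_less_divide_iff)
  moreover have "P \<xi> \<le> P m"
    using \<xi> z m by (intro mono pos) auto
  ultimately show False using Pm by simp
qed

text \<open>
  The difference \<open>w\<close> of two solutions solves the homogeneous equation, to which the maximum
  principle applies: the flux \<open>P\<close> of \<open>w\<close> is a primitive of \<open>c * w\<close> with \<open>c \<ge> 0\<close>. The two solutions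
  may come with different weak derivatives of \<open>a\<close>, which however agree almost everywhere.
  Exchanging the solutions yields uniqueness.
\<close>

lemma temperature_solution_le:
  assumes "0 < l" "\<beta> \<ge> 0" "\<beta>r \<ge> 0"
    and a: "continuous_on {0..l} a" "\<And>x. x \<in> {0..l} \<Longrightarrow> a x > 0"
    and T1: "temperature_solution l \<beta> \<beta>r Tinf Td a T1"
    and T2: "temperature_solution l \<beta> \<beta>r Tinf Td a T2"
    and x: "x \<in> {0..l}"
  shows "T1 x \<le> T2 x"
proof -
  obtain a1 S1 where 1: "has_weak_deriv l a a1" "has_weak_deriv l T1 S1"
    "has_weak_deriv l (\<lambda>x. (a x)\<^sup>2 * S1 x) (\<lambda>x. \<beta> * a x * sqrt (1 + (a1 x)\<^sup>2) * (T1 x - Tinf))"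
    using T1 unfolding temperature_solution_def by blast
  obtain a2 S2 where 2: "has_weak_deriv l a a2" "has_weak_deriv l T2 S2"
    "has_weak_deriv l (\<lambda>x. (a x)\<^sup>2 * S2 x) (\<lambda>x. \<beta> * a x * sqrt (1 + (a2 x)\<^sup>2) * (T2 x - Tinf))"
    using T2 unfolding temperature_solution_def by blast
  have T_cont: "continuous_on {0..l} T1" "continuous_on {0..l} T2"
    using T1 T2 unfolding temperature_solution_def W1_def by auto
  define w where "w x = T1 x - T2 x" for x
  define c where "c x = \<beta> * a x * sqrt (1 + (a1 x)\<^sup>2)" for x
  define h where "h x = c x * (T1 x - Tinf) - \<beta> * a x * sqrt (1 + (a2 x)\<^sup>2) * (T2 x - Tinf)" for x
  have h: "has_weak_deriv l (\<lambda>x. (a x)\<^sup>2 * S1 x - (a x)\<^sup>2 * S2 x) h"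
    unfolding h_def c_def by (rule has_weak_deriv_diff[OF 1(3) 2(3)])
  have h_int: "integrable (leb l) h" by (rule has_weak_derivD(2)[OF h])
  have h_AE: "AE x in leb l. h x = c x * w x"
    using weak_deriv_unique[OF 1(1) 2(1)]
    by eventually_elim (simp add: h_def c_def w_def algebra_simps)
  obtain k where k: "AE x in leb l. (a x)\<^sup>2 * S1 x - (a x)\<^sup>2 * S2 x = k + integral {0..x} h"
    using weak_deriv_AE_primitive[OF h \<open>0 < l\<close>] by blast
  define P where "P x = k + integral {0..x} h" for x
  have "AE x in leb l. x \<in> {0<..<l}"
    by (rule AE_I2) simp
  with k have S_AE: "AE x in leb l. S1 x - S2 x = P x / (a x)\<^sup>2"
  proof eventually_elim
    case (elim x)
    then have "a x > 0" using a(2)[of x] by simp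
    then show ?case
      using elim unfolding P_def right_diff_distrib[symmetric] by (simp add: field_simps)
  qed
  have P_cont: "continuous_on {0..l} (\<lambda>x. P x / (a x)\<^sup>2)"
    unfolding P_def
    by (intro continuous_intros continuous_on_primitive[OF h_int] a(1)) (use a(2) in force)
  have deriv: "(w has_real_derivative P x / (a x)\<^sup>2) (at x within {0..l})" if "x \<in> {0..l}" for x
    unfolding w_def
    by (rule has_real_derivative_if_weak_deriv[OF has_weak_deriv_diff[OF 1(2) 2(2)] \<open>0 < l\<close> _ P_cont S_AE that])
       (intro continuous_intros T_cont)
  have "w x \<le> 0"
  proof (rule maximum_principle[OF \<open>0 < l\<close> deriv _ _ _ _ x])
    show "(a x)\<^sup>2 > 0" if "x \<in> {0..l}" for x
      using a(2)[OF that] by simp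
    show "P x \<le> P y" if xy: "0 \<le> x" "x \<le> y" "y \<le> l" and pos: "\<And>z. z \<in> {x..y} \<Longrightarrow> 0 < w z" for x y
    proof -
      have "integral {x..y} h = integral {x..y} (\<lambda>z. c z * w z)"
        using xy by (intro integral_cong_AE_leb[OF h_AE]) auto
      also have "\<dots> \<ge> 0"
      proof (cases "(\<lambda>z. c z * w z) integrable_on {x..y}")
        case True
        moreover have "c z * w z \<ge> 0" if "z \<in> {x..y}" for z
          using a(2)[of z] pos[OF that] that xy \<open>\<beta> \<ge> 0\<close> by (simp add: c_def)
        ultimately show ?thesis
          by (rule Henstock_Kurzweil_Integration.integral_nonneg)
      qed (simp add: not_integrable_integral)
      finally have "integral {x..y} h \<ge> 0" .
      moreover have "integral {0..x} h + integral {x..y} h = integral {0..y} h"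
        using xy integrable_on_if_leb[OF h_int]
        by (intro Henstock_Kurzweil_Integration.integral_combine) auto
      ultimately show ?thesis by (simp add: P_def)
    qed
    show "w 0 \<le> 0"
      using T1 T2 by (simp add: temperature_solution_def w_def)
    show "P l \<le> 0" if "w l > 0"
    proof -
      have "(w has_real_derivative - \<beta>r * (T1 l - Tinf) - - \<beta>r * (T2 l - Tinf)) (at l within {0..l})"
        unfolding w_def using T1 T2 by (intro DERIV_diff) (auto simp: temperature_solution_def)
      moreover have "at l within {0..l} \<noteq> bot"
        using \<open>0 < l\<close> by (simp add: trivial_limit_within islimpt_Icc)
      ultimately have "P l / (a l)\<^sup>2 = - \<beta>r * w l"
        using deriv[of l] \<open>0 < l\<close> unfolding has_real_derivative_iff_has_vector_derivative
        by (auto simp: w_def algebra_simps dest: vector_derivative_unique_within)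
      also have "\<dots> \<le> 0" using that \<open>\<beta>r \<ge> 0\<close> by simp
      finally show ?thesis
        using a(2)[of l] \<open>0 < l\<close> by (simp add: divide_le_0_iff)
    qed
  qed
  then show ?thesis by (simp add: w_def)
qed

lemma L2_if_continuous:
  assumes "continuous_on {0..l} u"
  shows "u \<in> L2 l"
  unfolding L2_def
  by (auto intro!: measurable_leb_continuous assms integrable_leb_continuous continuous_intros)

text \<open>
  The excess \<open>u\<close> of the temperature over \<open>Tinf\<close> and its flux \<open>q = a\<^sup>2 u'\<close> form a first-order system.
  A pair solving it classically off finitely many points is a solution in the sense of
  distributions, because \<open>u\<close> and \<open>q\<close> are continuous, and it is the only one; hence the heat flux is
  determined by \<open>q 0\<close>.
\<close>

lemma heat_flux_classical:
  fixes a a' u q :: "real \<Rightarrow> real"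
  assumes "0 < l" "\<beta> \<ge> 0" "\<beta>r \<ge> 0" "finite S"
    and a: "continuous_on {0..l} a" "\<And>x. x \<in> {0..l} \<Longrightarrow> a x > 0"
    and a': "\<And>x. x \<in> {0<..<l} - S \<Longrightarrow> (a has_real_derivative a' x) (at x)"
      "a' \<in> borel_measurable (leb l)" "\<And>x. x \<in> {0<..<l} \<Longrightarrow> \<bar>a' x\<bar> \<le> C"
    and u: "continuous_on {0..l} u"
      "\<And>x. x \<in> {0<..<l} - S \<Longrightarrow> (u has_real_derivative q x / (a x)\<^sup>2) (at x)"
    and q: "continuous_on {0..l} q"
      "\<And>x. x \<in> {0<..<l} - S \<Longrightarrow>
        (q has_real_derivative \<beta> * a x * sqrt (1 + (a' x)\<^sup>2) * u x) (at x)"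
    and bc: "u 0 = Td - Tinf" "q l = - \<beta>r * (a l)\<^sup>2 * u l"
  shows "heat_flux k l \<beta> \<beta>r Tinf Td a = - k * pi * q 0"
proof -
  define T where "T = restrict (\<lambda>x. Tinf + u x) {0..l}"
  have T_eq: "T x = Tinf + u x" if "x \<in> {0..l}" for x
    using that by (simp add: T_def)
  define D where "D x = q x / (a x)\<^sup>2" for x
  have D: "continuous_on {0..l} D"
    unfolding D_def by (intro continuous_intros a(1) q(1)) (use a(2) in force)
  obtain BD where BD: "\<And>x. x \<in> {0..l} \<Longrightarrow> \<bar>D x\<bar> \<le> BD"
    using continuous_bounded_ivl[OF D] by blast
  have T_cont: "continuous_on {0..l} T"
    by (rule continuous_on_eq[of _ "\<lambda>x. Tinf + u x"]) (auto intro!: continuous_intros u(1) simp: T_eq)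
  have wd_T: "has_weak_deriv l T D"
  proof (rule has_weak_deriv_classical[OF \<open>0 < l\<close> \<open>finite S\<close> T_cont _ measurable_leb_continuous[OF D]])
    fix x assume x: "x \<in> {0<..<l} - S"
    have "((\<lambda>x. Tinf + u x) has_real_derivative D x) (at x)"
      using DERIV_add[OF DERIV_const u(2)[OF x]] by (simp add: D_def)
    then show "(T has_real_derivative D x) (at x)"
      by (rule has_field_derivative_transform_within_open[of _ _ _ "{0<..<l}"])
         (use x T_eq in auto)
  next
    show "\<bar>D x\<bar> \<le> BD" if "x \<in> {0<..<l}" for x
      using BD that by simp
  qed
  have wd_a: "has_weak_deriv l a a'"
    by (rule has_weak_deriv_classical[OF \<open>0 < l\<close> \<open>finite S\<close> a(1) a'])
  let ?r = "\<lambda>x. \<beta> * a x * sqrt (1 + (a' x)\<^sup>2) * u x"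
  obtain Ba Bu where B: "Ba > 0" "Bu > 0" "\<And>x. x \<in> {0..l} \<Longrightarrow> \<bar>a x\<bar> \<le> Ba"
    "\<And>x. x \<in> {0..l} \<Longrightarrow> \<bar>u x\<bar> \<le> Bu"
    using continuous_bounded_ivl[OF a(1)] continuous_bounded_ivl[OF u(1)] by metis
  have "has_weak_deriv l q ?r"
  proof (rule has_weak_deriv_classical[OF \<open>0 < l\<close> \<open>finite S\<close> q])
    show "?r \<in> borel_measurable (leb l)"
      using a'(2) measurable_leb_continuous[OF a(1)] measurable_leb_continuous[OF u(1)]
      by measurable
    show "\<bar>?r x\<bar> \<le> \<beta> * Ba * sqrt (1 + C\<^sup>2) * Bu" if "x \<in> {0<..<l}" for x
    proof -
      have "(a' x)\<^sup>2 \<le> C\<^sup>2"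
        using a'(3)[OF that] by (metis abs_ge_zero power2_abs power_mono)
      then show ?thesis
        using B that \<open>\<beta> \<ge> 0\<close> unfolding abs_mult
        by (intro mult_mono) auto
    qed
  qed
  then have wd_q: "has_weak_deriv l (\<lambda>x. (a x)\<^sup>2 * D x)
      (\<lambda>x. \<beta> * a x * sqrt (1 + (a' x)\<^sup>2) * (T x - Tinf))"
  proof (rule has_weak_deriv_cong)
    fix x assume x: "x \<in> {0<..<l}"
    then show "(a x)\<^sup>2 * D x = q x"
      using a(2)[of x] by (simp add: D_def)
    show "\<beta> * a x * sqrt (1 + (a' x)\<^sup>2) * (T x - Tinf) = ?r x"
      using x T_eq by simp
  qed
  have deriv: "(T has_real_derivative D x) (at x within {0..l})" if "x \<in> {0..l}" for x
    by (rule has_real_derivative_if_weak_deriv[OF wd_T \<open>0 < l\<close> T_cont D _ that]) simp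
  have sol: "temperature_solution l \<beta> \<beta>r Tinf Td a T"
    unfolding temperature_solution_def
  proof (intro conjI exI)
    show "T \<in> W1 l (L2 l)"
      unfolding W1_def using T_cont D wd_T by (auto intro: L2_if_continuous)
    show "T 0 = Td" using bc(1) \<open>0 < l\<close> by (simp add: T_eq)
    have "D l = - \<beta>r * (T l - Tinf)"
      using bc(2) a(2)[of l] \<open>0 < l\<close> by (simp add: D_def T_eq field_simps)
    then show "(T has_real_derivative - \<beta>r * (T l - Tinf)) (at l within {0..l})"
      using deriv[of l] \<open>0 < l\<close> by simp
  qed (rule wd_a wd_T wd_q)+
  have "temperature l \<beta> \<beta>r Tinf Td a = T"
    unfolding temperature_def
  proof (rule the_equality)
    show "T \<in> extensional {0..l} \<and> temperature_solution l \<beta> \<beta>r Tinf Td a T"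
      using sol by (simp add: T_def)
    fix T' assume T': "T' \<in> extensional {0..l} \<and> temperature_solution l \<beta> \<beta>r Tinf Td a T'"
    have le: "T1 x \<le> T2 x" if "temperature_solution l \<beta> \<beta>r Tinf Td a T1"
      "temperature_solution l \<beta> \<beta>r Tinf Td a T2" "x \<in> {0..l}" for T1 T2 x
      using temperature_solution_le[OF \<open>0 < l\<close> \<open>\<beta> \<ge> 0\<close> \<open>\<beta>r \<ge> 0\<close> a(1) _ that] a(2) by blast
    show "T' = T"
    proof (rule extensionalityI[of _ "{0..l}"])
      show "T' x = T x" if "x \<in> {0..l}" for x
        using le[OF conjunct2[OF T'] sol that] le[OF sol conjunct2[OF T'] that] by simp
    qed (use T' in \<open>auto simp: T_def\<close>)
  qed
  moreover have "vector_derivative T (at 0 within {0..l}) = D 0"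
    using deriv[of 0] \<open>0 < l\<close>
    by (intro vector_derivative_within_closed_interval)
       (auto simp: has_real_derivative_iff_has_vector_derivative)
  ultimately show ?thesis
    using a(2)[of 0] \<open>0 < l\<close> by (simp add: heat_flux_def D_def)
qed

section \<open>Explicit temperature on a catenary spike\<close>

definition catenary :: "real \<Rightarrow> real \<Rightarrow> real \<Rightarrow> real \<Rightarrow> real"
  where "catenary C \<theta> e x = C * cosh (\<theta> + (e - x) / C)"

lemma has_real_derivative_catenary:
  assumes "C \<noteq> 0"
  shows "(catenary C \<theta> e has_real_derivative - sinh (\<theta> + (e - x) / C)) (at x)"
  unfolding catenary_def[abs_def] using assms
  by (auto intro!: derivative_eq_intros simp: field_simps)

lemma catenary_pos: "C > 0 \<Longrightarrow> catenary C \<theta> e x > 0"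
  by (simp add: catenary_def)

text \<open>
  For \<open>a = C cosh (\<theta> + (e - x) / C)\<close> the surface element satisfies
  \<open>a * sqrt (1 + a'\<^sup>2) = a\<^sup>2 / C\<close>, and the equation is \<open>(a\<^sup>2 u')' = (\<beta> / C) a\<^sup>2 u\<close>. In terms of \<open>v = a u\<close>
  the flux is \<open>a v' - a' v\<close> and the equation becomes \<open>v'' = (1 / C\<^sup>2 + \<beta> / C) v\<close>, because
  \<open>a'' = a / C\<^sup>2\<close>. The solution is therefore explicit for arbitrary Cauchy data \<open>U\<close>, \<open>Q\<close> at \<open>e\<close>; with
  the signs of \<open>U\<close> and \<open>Q\<close> assumed here, its coefficients satisfy \<open>A > 0\<close> and \<open>B \<ge> 0\<close>, so that
  \<open>u\<close> is positive to the left of \<open>e\<close>.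
\<close>

lemma catenary_solution:
  assumes "C > 0" "\<beta> > 0" "\<theta> \<ge> 0" "U > 0" "Q \<le> 0"
  obtains u q where
    "\<And>x. (u has_real_derivative q x / (catenary C \<theta> e x)\<^sup>2) (at x)"
    "\<And>x. (q has_real_derivative \<beta> / C * (catenary C \<theta> e x)\<^sup>2 * u x) (at x)"
    "u e = U" "q e = Q" "\<And>x. x \<le> e \<Longrightarrow> u x > 0"
proof -
  let ?a = "catenary C \<theta> e"
  define \<mu> where "\<mu> = sqrt (1 / C\<^sup>2 + \<beta> / C)"
  have \<mu>2: "\<mu>\<^sup>2 = 1 / C\<^sup>2 + \<beta> / C" and \<mu>: "\<mu> > 0"
    using assms unfolding \<mu>_def by (auto intro!: add_pos_pos)
  define A where "A = C * cosh \<theta> * U"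
  define B where "B = (sinh \<theta> * A - Q) / (C * cosh \<theta> * \<mu>)"
  have A: "A > 0" using assms by (simp add: A_def)
  have B: "B \<ge> 0" unfolding B_def using assms A \<mu>
    by (intro divide_nonneg_pos mult_pos_pos cosh_real_pos) (auto intro!: order_trans[OF \<open>Q \<le> 0\<close>])
  define v where "v x = A * cosh (\<mu> * (e - x)) + B * sinh (\<mu> * (e - x))" for x
  define v' where "v' x = - \<mu> * (A * sinh (\<mu> * (e - x)) + B * cosh (\<mu> * (e - x)))" for x
  have v: "(v has_real_derivative v' x) (at x)" for x
    unfolding v_def[abs_def] v'_def
    by (auto intro!: derivative_eq_intros simp: algebra_simps)
  have v': "(v' has_real_derivative \<mu>\<^sup>2 * v x) (at x)" for x
    unfolding v_def v'_def[abs_def]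
    by (auto intro!: derivative_eq_intros simp: algebra_simps power2_eq_square)
  define s where "s x = sinh (\<theta> + (e - x) / C)" for x
  have a: "(?a has_real_derivative - s x) (at x)" for x
    unfolding s_def using \<open>C > 0\<close> by (intro has_real_derivative_catenary) simp
  have s: "(s has_real_derivative - ?a x / C\<^sup>2) (at x)" for x
    unfolding s_def[abs_def] catenary_def using \<open>C > 0\<close>
    by (auto intro!: derivative_eq_intros simp: field_simps power2_eq_square)
  note a_pos = catenary_pos[OF \<open>C > 0\<close>, of \<theta> e]
  define q where "q x = ?a x * v' x + s x * v x" for x
  show ?thesis
  proof (rule that[of "\<lambda>x. v x / ?a x" q])
    show "((\<lambda>x. v x / ?a x) has_real_derivative q x / (?a x)\<^sup>2) (at x)" for x
      using a_pos[of x]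
      by (auto intro!: derivative_eq_intros v a simp: q_def power2_eq_square field_simps)
    have "(q has_real_derivative ?a x * (\<mu>\<^sup>2 * v x) - ?a x / C\<^sup>2 * v x) (at x)" for x
      unfolding q_def[abs_def]
      by (auto intro!: derivative_eq_intros v v' a s simp: algebra_simps)
    moreover have "?a x * (\<mu>\<^sup>2 * v x) - ?a x / C\<^sup>2 * v x = \<beta> / C * (?a x)\<^sup>2 * (v x / ?a x)" for x
      using a_pos[of x] unfolding \<mu>2 by (simp add: power2_eq_square algebra_simps)
    ultimately show "(q has_real_derivative \<beta> / C * (?a x)\<^sup>2 * (v x / ?a x)) (at x)" for x
      by simp
    show "v e / ?a e = U"
      using assms by (simp add: v_def catenary_def A_def)
    show "q e = Q"
      using assms \<mu> by (simp add: q_def v_def v'_def s_def catenary_def B_def)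
    show "v x / ?a x > 0" if "x \<le> e" for x
      using that A B \<mu> a_pos[of x] unfolding v_def
      by (intro divide_pos_pos add_pos_nonneg mult_pos_pos mult_nonneg_nonneg) auto
  qed
qed

text \<open>
  On a fin of constant radius \<open>a0\<close> the equation is \<open>u'' = (\<beta> / a0) u\<close>. The ratio \<open>- u' / u\<close> is at
  least \<open>m * tanh (m * (l - x))\<close> with \<open>m\<^sup>2 = \<beta> / a0\<close>, for every \<open>\<beta>r \<ge> 0\<close>; on the left half
  of the interval this is bounded below by a constant \<open>\<delta>\<close>, which serves all spikes that end
  there.
\<close>

lemma cylinder_solution:
  assumes "l > 0" "\<beta> > 0" "\<beta>r \<ge> 0" "a0 > 0"
  obtains u q \<delta> where "\<delta> > 0"
    "\<And>x. (u has_real_derivative q x / a0\<^sup>2) (at x)"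
    "\<And>x. (q has_real_derivative \<beta> * a0 * u x) (at x)"
    "q l = - \<beta>r * a0\<^sup>2 * u l" "\<And>x. x \<le> l \<Longrightarrow> u x > 0"
    "\<And>x. x \<le> l / 2 \<Longrightarrow> q x \<le> - \<delta> * a0\<^sup>2 * u x"
proof -
  define m where "m = sqrt (\<beta> / a0)"
  have m2: "m\<^sup>2 = \<beta> / a0" and m: "m > 0"
    using assms unfolding m_def by auto
  define u where "u x = cosh (m * (l - x)) + \<beta>r / m * sinh (m * (l - x))" for x
  define q where "q x = - a0\<^sup>2 * (m * sinh (m * (l - x)) + \<beta>r * cosh (m * (l - x)))" for x
  define \<delta> where "\<delta> = m * tanh (m * (l / 2))"
  have \<delta>: "\<delta> > 0" "\<delta> \<le> m"
    using m \<open>l > 0\<close> tanh_real_lt_1[of "m * (l / 2)"] by (auto simp: \<delta>_def mult_le_cancel_left1)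
  show ?thesis
  proof (rule that[of \<delta> u q])
    show "(u has_real_derivative q x / a0\<^sup>2) (at x)" for x
      unfolding u_def[abs_def] q_def using m \<open>a0 > 0\<close>
      by (auto intro!: derivative_eq_intros simp: field_simps)
    have "(q has_real_derivative a0\<^sup>2 * m\<^sup>2 * u x) (at x)" for x
      unfolding q_def[abs_def] u_def using m
      by (auto intro!: derivative_eq_intros simp: algebra_simps power2_eq_square)
    then show "(q has_real_derivative \<beta> * a0 * u x) (at x)" for x
      using \<open>a0 > 0\<close> unfolding m2 by (simp add: power2_eq_square mult_ac)
    show "q l = - \<beta>r * a0\<^sup>2 * u l"
      by (simp add: q_def u_def)
    show "u x > 0" if "x \<le> l" for x
      unfolding u_def using that m \<open>\<beta>r \<ge> 0\<close>
      by (intro add_pos_nonneg mult_nonneg_nonneg) auto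
    show "q x \<le> - \<delta> * a0\<^sup>2 * u x" if "x \<le> l / 2" for x
    proof -
      let ?y = "m * (l - x)"
      have "tanh (m * (l / 2)) \<le> tanh ?y"
        using that m by simp
      then have "tanh (m * (l / 2)) * cosh ?y \<le> tanh ?y * cosh ?y"
        by (intro mult_right_mono) auto
      also have "\<dots> = sinh ?y"
        by (simp add: tanh_def)
      finally have "\<delta> * cosh ?y \<le> m * sinh ?y"
        using m by (simp add: \<delta>_def)
      moreover have "\<delta> * (\<beta>r / m * sinh ?y) \<le> \<beta>r * cosh ?y"
      proof -
        have "\<delta> * (\<beta>r / m * sinh ?y) = (\<delta> / m) * (\<beta>r * sinh ?y)" by simp
        also have "\<dots> \<le> 1 * (\<beta>r * cosh ?y)"
          using \<delta> m \<open>\<beta>r \<ge> 0\<close> that \<open>l > 0\<close> sinh_le_cosh_real[of ?y]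
          by (intro mult_mono mult_left_mono) auto
        finally show ?thesis by simp
      qed
      ultimately have "\<delta> * u x \<le> m * sinh ?y + \<beta>r * cosh ?y"
        unfolding u_def by (simp add: distrib_left)
      then show ?thesis
        unfolding q_def using mult_left_mono[of _ _ "a0\<^sup>2"] by (fastforce simp: algebra_simps)
    qed
  qed (fact \<delta>)
qed

text \<open>
  A lower bound for \<open>- u' / u\<close> propagates from \<open>e\<close> to the left. The function \<open>z = q + \<delta> a\<^sup>2 u\<close> satisfies
  \<open>z' = \<delta> z + a u (\<beta> a / C + 2 \<delta> a' - \<delta>\<^sup>2 a)\<close>. The last bracket is nonnegative: \<open>\<bar>a'\<bar> \<le> a / C\<close> on
  a catenary, so that the gain \<open>\<beta> a / C\<close> through the lateral surface dominates for small \<open>\<delta>\<close>. Thus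
  \<open>exp (- \<delta> x) * z\<close> increases, and it is not positive at \<open>e\<close>.
\<close>

lemma catenary_flux_bound:
  assumes "C > 0" "0 \<le> e" "\<delta> \<ge> 0" "\<delta> * (2 + \<delta> * C) \<le> \<beta>"
    and u: "\<And>x. (u has_real_derivative q x / (catenary C \<theta> e x)\<^sup>2) (at x)" "\<And>x. x \<le> e \<Longrightarrow> u x > 0"
    and q: "\<And>x. (q has_real_derivative \<beta> / C * (catenary C \<theta> e x)\<^sup>2 * u x) (at x)"
    and end_bound: "q e \<le> - \<delta> * (catenary C \<theta> e e)\<^sup>2 * u e"
  shows "q 0 \<le> - \<delta> * (catenary C \<theta> e 0)\<^sup>2 * u 0"
proof -
  let ?a = "catenary C \<theta> e"
  define z where "z x = exp (- \<delta> * x) * (q x + \<delta> * (?a x)\<^sup>2 * u x)" for x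
  have "z 0 \<le> z e"
  proof (rule DERIV_nonneg_imp_nondecreasing[OF \<open>0 \<le> e\<close>])
    fix x assume x: "0 \<le> x" "x \<le> e"
    let ?s = "sinh (\<theta> + (e - x) / C)"
    let ?D = "exp (- \<delta> * x) * (?a x * u x * (?a x * (\<beta> / C - \<delta>\<^sup>2) - 2 * \<delta> * ?s))"
    note a_pos = catenary_pos[OF \<open>C > 0\<close>, of \<theta> e x]
    have "(z has_real_derivative ?D) (at x)"
      unfolding z_def[abs_def] using a_pos \<open>C > 0\<close>
      by (auto intro!: derivative_eq_intros u(1) q has_real_derivative_catenary
          simp: field_simps power2_eq_square)
    moreover have "?D \<ge> 0"
    proof -
      have "?s \<le> ?a x / C"
        using \<open>C > 0\<close> sinh_le_cosh_real by (simp add: catenary_def)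
      then have "2 * \<delta> * ?s \<le> 2 * \<delta> * (?a x / C)"
        using \<open>\<delta> \<ge> 0\<close> by (intro mult_left_mono) auto
      also have "\<dots> \<le> ?a x * (\<beta> / C - \<delta>\<^sup>2)"
      proof -
        have "2 * \<delta> / C \<le> \<beta> / C - \<delta>\<^sup>2"
          using assms(4) \<open>C > 0\<close> by (simp add: field_simps power2_eq_square)
        then have "?a x * (2 * \<delta> / C) \<le> ?a x * (\<beta> / C - \<delta>\<^sup>2)"
          using a_pos by (intro mult_left_mono) auto
        then show ?thesis by (simp add: mult_ac)
      qed
      finally show ?thesis
        using a_pos u(2)[OF x(2)] by (intro mult_nonneg_nonneg) auto
    qed
    ultimately show "\<exists>y. (z has_real_derivative y) (at x) \<and> 0 \<le> y" by blast
  qed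
  also have "z e \<le> 0"
    using end_bound by (auto simp: z_def mult_le_0_iff)
  finally show ?thesis by (simp add: z_def)
qed

lemma has_real_derivative_glue:
  assumes "x \<noteq> e" "x < e \<Longrightarrow> (f has_real_derivative D) (at x)"
    "e < x \<Longrightarrow> (g has_real_derivative D) (at x)"
  shows "((\<lambda>x. if x \<le> e then f x else g x) has_real_derivative D) (at x)"
proof (cases "x < e")
  case True
  show ?thesis
    by (rule has_field_derivative_transform_within_open[OF assms(2)[OF True], of "{..<e}"])
       (use True in auto)
next
  case False
  then have "e < x" using assms(1) by simp
  show ?thesis
    by (rule has_field_derivative_transform_within_open[OF assms(3)[OF \<open>e < x\<close>], of "{e<..}"])
       (use \<open>e < x\<close> in auto)
qed

lemma continuous_on_glue:
  assumes "\<And>x. (f has_real_derivative f' x) (at x)" "\<And>x. (g has_real_derivative g' x) (at x)"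
    "f e = g e"
  shows "continuous_on S (\<lambda>x::real. if x \<le> e then f x else g x)"
proof (rule continuous_on_cases_le)
  show "continuous_on {x \<in> S. x \<le> e} f" "continuous_on {x \<in> S. e \<le> x} g"
    using assms(1,2) by (auto intro!: DERIV_continuous_on intro: DERIV_subset)
qed (use assms(3) in \<open>auto intro: continuous_intros\<close>)

lemma Linf_if_bounded:
  assumes "f \<in> borel_measurable (leb l)" "\<And>x. x \<in> {0<..<l} \<Longrightarrow> \<bar>f x\<bar> \<le> B"
  shows "f \<in> Linf l"
proof -
  have "AE x in leb l. \<bar>f x\<bar> \<le> B"
    using assms(2) by (intro AE_I2) simp
  then show ?thesis
    unfolding Linf_def using assms(1) by blast
qed

text \<open>
  The angle \<open>arcosh (a0 / C)\<close> is chosen for the catenary to have the value \<open>a0\<close> at its foot \<open>e\<close>,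
  where it meets the cylinder of radius \<open>a0\<close>.
\<close>

definition spike :: "real \<Rightarrow> real \<Rightarrow> real \<Rightarrow> real \<Rightarrow> real"
  where "spike C e a0 x = (if x \<le> e then catenary C (arcosh (a0 / C)) e x else a0)"

definition spike_slope :: "real \<Rightarrow> real \<Rightarrow> real \<Rightarrow> real \<Rightarrow> real"
  where "spike_slope C e a0 x = (if x \<le> e then - sinh (arcosh (a0 / C) + (e - x) / C) else 0)"

text \<open>
  The parameter \<open>t\<close> fixes the height of the spike, between \<open>a0 * cosh t\<close> and \<open>a0 * exp t\<close>,
  independently of \<open>C\<close>, while its width \<open>e = C * t\<close> shrinks with \<open>C\<close>.
\<close>

context
  fixes C e a0 t :: real
  assumes C: "0 < C" "C \<le> a0" and e: "e = C * t" and t: "t \<ge> 0"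
begin

lemma cosh_angle: "C * cosh (arcosh (a0 / C)) = a0" and angle_nonneg: "arcosh (a0 / C) \<ge> 0"
  using C by (auto simp: cosh_arcosh_real)

lemma catenary_ge: "x \<le> e \<Longrightarrow> a0 \<le> catenary C (arcosh (a0 / C)) e x"
proof -
  assume "x \<le> e"
  then have "cosh (arcosh (a0 / C)) \<le> cosh (arcosh (a0 / C) + (e - x) / C)"
    using angle_nonneg C by (subst cosh_real_nonneg_le_iff) auto
  then show ?thesis
    using C mult_left_mono[of _ _ C] cosh_angle by (fastforce simp: catenary_def)
qed

lemma spike_ge: "a0 \<le> spike C e a0 x"
  using catenary_ge by (simp add: spike_def)

lemma catenary_le:
  assumes "0 \<le> x" "x \<le> e"
  shows "catenary C (arcosh (a0 / C)) e x \<le> a0 * exp t"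
proof -
  let ?\<theta> = "arcosh (a0 / C)" and ?s = "(e - x) / C"
  have s: "0 \<le> ?s" "?s \<le> t"
    using assms C e by (auto simp: field_simps)
  have "cosh (?\<theta> + ?s) \<le> cosh ?\<theta> * cosh ?s + cosh ?\<theta> * sinh ?s"
    unfolding cosh_add using s sinh_le_cosh_real[of ?\<theta>]
    by (intro add_left_mono mult_right_mono) auto
  also have "\<dots> = cosh ?\<theta> * exp ?s"
    by (simp add: cosh_plus_sinh distrib_left[symmetric])
  also have "\<dots> \<le> cosh ?\<theta> * exp t"
    using s by (intro mult_left_mono) auto
  finally have "C * cosh (?\<theta> + ?s) \<le> C * (cosh ?\<theta> * exp t)"
    using C by (intro mult_left_mono) auto
  then show ?thesis
    using cosh_angle by (simp add: catenary_def mult.assoc[symmetric])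
qed

lemma spike_0_ge: "a0 * cosh t \<le> spike C e a0 0"
proof -
  let ?\<theta> = "arcosh (a0 / C)"
  have "cosh ?\<theta> * cosh t \<le> cosh (?\<theta> + t)"
    unfolding cosh_add using angle_nonneg t by simp
  then have "C * (cosh ?\<theta> * cosh t) \<le> C * cosh (?\<theta> + t)"
    using C by (intro mult_left_mono) auto
  then show ?thesis
    using cosh_angle C t e by (simp add: spike_def catenary_def mult.assoc[symmetric])
qed

lemma continuous_spike: "continuous_on S (spike C e a0)"
  unfolding spike_def[abs_def]
proof (rule continuous_on_glue[OF has_real_derivative_catenary DERIV_const])
  show "C \<noteq> 0" using C by simp
  show "catenary C (arcosh (a0 / C)) e e = a0"
    using cosh_angle by (simp add: catenary_def)
qed

lemma spike_deriv: "x \<noteq> e \<Longrightarrow> (spike C e a0 has_real_derivative spike_slope C e a0 x) (at x)"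
  unfolding spike_def[abs_def] spike_slope_def using C
  by (intro has_real_derivative_glue) (auto intro: has_real_derivative_catenary)

lemma spike_slope_measurable: "spike_slope C e a0 \<in> borel_measurable (leb l)"
proof -
  have "spike_slope C e a0 \<in> borel_measurable borel"
    unfolding spike_slope_def[abs_def] sinh_def by measurable
  then show ?thesis
    by (intro measurable_restrict_space1 measurable_completion) simp
qed

lemma spike_slope_bounded: "0 \<le> x \<Longrightarrow> \<bar>spike_slope C e a0 x\<bar> \<le> sinh (arcosh (a0 / C) + t)"
proof -
  assume "0 \<le> x"
  then have "(e - x) / C \<le> t" using C e by (simp add: field_simps)
  moreover have "0 \<le> (e - x) / C" if "x \<le> e" using that C by simp
  ultimately show ?thesis
    using angle_nonneg t by (auto simp: spike_slope_def)
qed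

lemma spike_lateral_element:
  "spike C e a0 x * sqrt (1 + (spike_slope C e a0 x)\<^sup>2) =
    (if x \<le> e then (catenary C (arcosh (a0 / C)) e x)\<^sup>2 / C else a0)"
proof -
  have "sqrt (1 + (sinh y)\<^sup>2) = cosh y" for y :: real
    by (metis add.commute cosh_real_nonneg cosh_square_eq real_sqrt_unique)
  then show ?thesis
    using C by (simp add: spike_def spike_slope_def catenary_def power2_eq_square)
qed

lemma spike_weak_deriv:
  assumes "0 < l"
  shows "has_weak_deriv l (spike C e a0) (spike_slope C e a0)"
  by (rule has_weak_deriv_classical[OF assms, of "{e}"])
     (auto intro: continuous_spike spike_deriv spike_slope_measurable spike_slope_bounded)

lemma spike_admissible:
  assumes "0 < l" "e \<le> l" "l * a0\<^sup>2 + e * (a0 * exp t)\<^sup>2 \<le> V0"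
  shows "spike C e a0 \<in> admissible a0 l V0"
proof -
  let ?a = "spike C e a0"
  have e0: "0 \<le> e" using C t e by simp
  obtain Ba where Ba: "\<And>x. x \<in> {0..l} \<Longrightarrow> \<bar>?a x\<bar> \<le> Ba"
    using continuous_bounded_ivl[OF continuous_spike] by blast
  have "?a \<in> Linf l"
    by (rule Linf_if_bounded[OF measurable_leb_continuous[OF continuous_spike]]) (rule Ba, simp)
  moreover have "spike_slope C e a0 \<in> Linf l"
    by (rule Linf_if_bounded[OF spike_slope_measurable]) (rule spike_slope_bounded, simp)
  ultimately have W1: "?a \<in> W1 l (Linf l)"
    unfolding W1_def using spike_weak_deriv[OF \<open>0 < l\<close>] continuous_spike by auto
  have sq_cont: "continuous_on S (\<lambda>x. (?a x)\<^sup>2)" for S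
    by (intro continuous_intros continuous_spike)
  have int: "(\<lambda>x. (?a x)\<^sup>2) integrable_on {x..y}" for x y
    by (intro integrable_continuous_real sq_cont)
  have "(LINT x|lebesgue_on {0..l}. (?a x)\<^sup>2) = integral {0..l} (\<lambda>x. (?a x)\<^sup>2)"
    by (intro lebesgue_integral_eq_integral continuous_imp_integrable_real sq_cont) simp
  also have "\<dots> = integral {0..e} (\<lambda>x. (?a x)\<^sup>2) + integral {e..l} (\<lambda>x. (?a x)\<^sup>2)"
    using e0 \<open>e \<le> l\<close> int by (intro Henstock_Kurzweil_Integration.integral_combine[symmetric]) auto
  also have "integral {0..e} (\<lambda>x. (?a x)\<^sup>2) \<le> integral {0..e} (\<lambda>x. (a0 * exp t)\<^sup>2)"
  proof (intro integral_le int power_mono)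
    show "?a x \<le> a0 * exp t" if "x \<in> {0..e}" for x
      using catenary_le that by (simp add: spike_def)
    show "0 \<le> ?a x" for x
      using spike_ge[of x] C by simp
  qed auto
  also have "integral {e..l} (\<lambda>x. (?a x)\<^sup>2) = integral {e..l} (\<lambda>x. a0\<^sup>2)"
    using cosh_angle by (intro integral_cong) (auto simp: spike_def catenary_def)
  also have "integral {0..e} (\<lambda>x. (a0 * exp t)\<^sup>2) + integral {e..l} (\<lambda>x. a0\<^sup>2) =
      e * (a0 * exp t)\<^sup>2 + (l - e) * a0\<^sup>2"
    using e0 \<open>e \<le> l\<close> by simp
  also have "\<dots> \<le> e * (a0 * exp t)\<^sup>2 + l * a0\<^sup>2"
    using e0 by (intro add_left_mono mult_right_mono) auto
  also have "\<dots> \<le> V0" using assms(3) by simp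
  finally have "(LINT x|lebesgue_on {0..l}. (?a x)\<^sup>2) \<le> V0" by simp
  then show ?thesis
    unfolding admissible_def using W1 spike_ge by simp
qed

end

section \<open>Unboundedness of the heat flux\<close>

text \<open>
  The cylinder solution provides Cauchy data at the foot of the spike, the catenary solution
  continues it to \<open>0\<close>, and the pair is scaled to have the prescribed temperature there. The bound
  \<open>- q \<ge> \<delta> a\<^sup>2 u\<close> is transported from the foot to \<open>0\<close>, where \<open>a\<close> is large. It is essential that \<open>\<delta>\<close>
  does not depend on \<open>C\<close> and \<open>t\<close>.
\<close>

lemma spike_heat_flux_ge:
  assumes "k \<ge> 0" "\<beta> > 0" "\<beta>r \<ge> 0" "Tinf < Td" "a0 > 0" "l > 0"
  obtains \<delta> where "\<delta> > 0"
    "\<And>C t. 0 < C \<Longrightarrow> C \<le> a0 \<Longrightarrow> 0 \<le> t \<Longrightarrow> C * t \<le> l / 2 \<Longrightarrow>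
      k * pi * (Td - Tinf) * \<delta> * (a0 * cosh t)\<^sup>2 \<le> heat_flux k l \<beta> \<beta>r Tinf Td (spike C (C * t) a0)"
proof -
  obtain u2 q2 \<delta>2 where "\<delta>2 > 0"
    and u2: "\<And>x. (u2 has_real_derivative q2 x / a0\<^sup>2) (at x)" "\<And>x. x \<le> l \<Longrightarrow> u2 x > 0"
    and q2: "\<And>x. (q2 has_real_derivative \<beta> * a0 * u2 x) (at x)"
      "q2 l = - \<beta>r * a0\<^sup>2 * u2 l" "\<And>x. x \<le> l / 2 \<Longrightarrow> q2 x \<le> - \<delta>2 * a0\<^sup>2 * u2 x"
    using cylinder_solution[OF \<open>l > 0\<close> \<open>\<beta> > 0\<close> \<open>\<beta>r \<ge> 0\<close> \<open>a0 > 0\<close>] by metis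
  \<comment> \<open>The last entry ensures \<delta> (2 + \<delta> C) \<le> \<beta> for all C \<le> a0, given that \<delta> \<le> 1.\<close>
  define \<delta> where "\<delta> = Min {1, \<delta>2, \<beta> / (2 + a0)}"
  have \<delta>: "\<delta> > 0" "\<delta> \<le> 1" "\<delta> \<le> \<delta>2" "\<delta> \<le> \<beta> / (2 + a0)"
    using \<open>\<delta>2 > 0\<close> \<open>\<beta> > 0\<close> \<open>a0 > 0\<close> by (auto simp: \<delta>_def)
  show ?thesis
  proof (rule that[OF \<delta>(1)])
    fix C t :: real
    assume C: "0 < C" "C \<le> a0" and t: "0 \<le> t" and small: "C * t \<le> l / 2"
    define e where "e = C * t"
    have e: "0 \<le> e" "e \<le> l / 2" using C t small by (auto simp: e_def)
    note par = C e_def t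
    let ?a = "spike C e a0" and ?\<theta> = "arcosh (a0 / C)"
    let ?c = "catenary C ?\<theta> e"
    have ce: "?c e = a0" using cosh_angle[OF par] by (simp add: catenary_def)
    have q2e: "q2 e \<le> - \<delta> * a0\<^sup>2 * u2 e"
    proof -
      have "\<delta> * (a0\<^sup>2 * u2 e) \<le> \<delta>2 * (a0\<^sup>2 * u2 e)"
        using u2(2)[of e] e \<open>l > 0\<close> \<delta> by (intro mult_right_mono) auto
      with q2(3)[OF e(2)] show ?thesis by (simp add: mult_ac)
    qed
    also have "\<dots> \<le> 0"
      using \<delta> u2(2)[of e] e \<open>l > 0\<close> by (simp add: mult_nonpos_nonneg)
    finally have "q2 e \<le> 0" .
    moreover have "u2 e > 0" using u2(2)[of e] e \<open>l > 0\<close> by simp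
    ultimately obtain u1 q1 where
      u1: "\<And>x. (u1 has_real_derivative q1 x / (?c x)\<^sup>2) (at x)" "u1 e = u2 e" "\<And>x. x \<le> e \<Longrightarrow> u1 x > 0"
      and q1: "\<And>x. (q1 has_real_derivative \<beta> / C * (?c x)\<^sup>2 * u1 x) (at x)" "q1 e = q2 e"
      using catenary_solution[OF \<open>0 < C\<close> \<open>\<beta> > 0\<close> angle_nonneg[OF par]] by metis
    have "\<delta> * (2 + \<delta> * C) \<le> \<beta>"
    proof -
      have "\<delta> * (2 + \<delta> * C) \<le> \<delta> * (2 + 1 * a0)"
        using \<delta> C by (intro mult_left_mono add_left_mono mult_mono) auto
      also have "\<dots> \<le> \<beta>" using \<delta>(4) \<open>a0 > 0\<close> by (simp add: field_simps)
      finally show ?thesis .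
    qed
    then have q1_0: "q1 0 \<le> - \<delta> * (?c 0)\<^sup>2 * u1 0"
      using \<open>0 < C\<close> e \<delta> u1(1,3) q1(1) q2e ce u1(2) q1(2)
      by (intro catenary_flux_bound[where \<beta>=\<beta>]) auto
    define s where "s = (Td - Tinf) / u1 0"
    have u1_0: "u1 0 > 0" using u1(3) e by simp
    then have s: "s > 0" using \<open>Tinf < Td\<close> by (simp add: s_def)
    define u where "u x = s * (if x \<le> e then u1 x else u2 x)" for x
    define q where "q x = s * (if x \<le> e then q1 x else q2 x)" for x
    have "heat_flux k l \<beta> \<beta>r Tinf Td ?a = - k * pi * q 0"
    proof (rule heat_flux_classical[OF \<open>l > 0\<close> _ \<open>\<beta>r \<ge> 0\<close>, of _ "{e}" _ "spike_slope C e a0"])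
      show "continuous_on {0..l} ?a" by (rule continuous_spike[OF par])
      show "?a x > 0" for x using spike_ge[OF par, of x] \<open>a0 > 0\<close> by simp
      show "spike_slope C e a0 \<in> borel_measurable (leb l)" by (rule spike_slope_measurable[OF par])
      show "continuous_on {0..l} u" "continuous_on {0..l} q"
        unfolding u_def q_def
        by (intro continuous_intros continuous_on_glue[OF u1(1) u2(1)] continuous_on_glue[OF q1(1) q2(1)]
            u1(2) q1(2))+
      fix x
      { assume "x \<in> {0<..<l}"
        then show "\<bar>spike_slope C e a0 x\<bar> \<le> sinh (?\<theta> + t)"
          using spike_slope_bounded[OF par] by simp }
      assume "x \<in> {0<..<l} - {e}"
      then have x: "x \<noteq> e" by simp
      then show "(?a has_real_derivative spike_slope C e a0 x) (at x)"
        by (rule spike_deriv[OF par])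
      have "((\<lambda>x. if x \<le> e then u1 x else u2 x) has_real_derivative
          (if x \<le> e then q1 x else q2 x) / (?a x)\<^sup>2) (at x)"
        by (rule has_real_derivative_glue[OF x]) (use u1(1)[of x] u2(1)[of x] in \<open>auto simp: spike_def\<close>)
      then show "(u has_real_derivative q x / (?a x)\<^sup>2) (at x)"
        unfolding u_def q_def by (auto dest: DERIV_cmult[where c=s])
      let ?w = "if x \<le> e then (?c x)\<^sup>2 / C else a0"
      have "((\<lambda>x. if x \<le> e then q1 x else q2 x) has_real_derivative
          \<beta> * ?w * (if x \<le> e then u1 x else u2 x)) (at x)"
        by (rule has_real_derivative_glue[OF x]) (use q1(1)[of x] q2(1)[of x] in auto)
      then have "(q has_real_derivative s * (\<beta> * ?w * (if x \<le> e then u1 x else u2 x))) (at x)"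
        unfolding q_def by (rule DERIV_cmult)
      also have "s * (\<beta> * ?w * (if x \<le> e then u1 x else u2 x)) =
          \<beta> * (?a x * sqrt (1 + (spike_slope C e a0 x)\<^sup>2)) * u x"
        unfolding spike_lateral_element[OF par] by (simp add: u_def)
      finally show "(q has_real_derivative \<beta> * ?a x * sqrt (1 + (spike_slope C e a0 x)\<^sup>2) * u x) (at x)"
        by (simp add: mult.assoc)
    next
      show "u 0 = Td - Tinf"
        using e u1_0 by (simp add: u_def s_def)
      have "e < l" using e \<open>l > 0\<close> by simp
      then show "q l = - \<beta>r * (?a l)\<^sup>2 * u l"
        using q2(2) by (simp add: q_def u_def spike_def)
    qed (use \<open>\<beta> > 0\<close> in auto)
    moreover have "(Td - Tinf) * \<delta> * (a0 * cosh t)\<^sup>2 \<le> - q 0"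
    proof -
      have "(a0 * cosh t)\<^sup>2 \<le> (?c 0)\<^sup>2"
        using spike_0_ge[OF par] e \<open>a0 > 0\<close> by (intro power_mono) (auto simp: spike_def)
      then have "(Td - Tinf) * \<delta> * (a0 * cosh t)\<^sup>2 \<le> (Td - Tinf) * \<delta> * (?c 0)\<^sup>2"
        using \<open>Tinf < Td\<close> \<delta> by (intro mult_left_mono) auto
      also have "\<dots> = s * (\<delta> * (?c 0)\<^sup>2 * u1 0)"
        using u1_0 by (simp add: s_def)
      also have "\<dots> \<le> s * - q1 0"
        using q1_0 s by (intro mult_left_mono) auto
      also have "\<dots> = - q 0" using e by (simp add: q_def)
      finally show ?thesis .
    qed
    then have "k * pi * ((Td - Tinf) * \<delta> * (a0 * cosh t)\<^sup>2) \<le> k * pi * - q 0"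
      using \<open>k \<ge> 0\<close> by (intro mult_left_mono) auto
    ultimately show "k * pi * (Td - Tinf) * \<delta> * (a0 * cosh t)\<^sup>2 \<le>
        heat_flux k l \<beta> \<beta>r Tinf Td (spike C (C * t) a0)"
      by (simp add: e_def mult_ac)
  qed
qed

text \<open>
  First the height \<open>t\<close> is chosen to make the flux large, then the scale \<open>C\<close> to make the spike
  narrow enough for the volume constraint.
\<close>

lemma heat_flux_unbounded:
  assumes "k > 0" "\<beta> > 0" "\<beta>r \<ge> 0" "Tinf < Td" "a0 > 0" "l > 0" "V0 > l * a0\<^sup>2"
  obtains a where "a \<in> admissible a0 l V0" "heat_flux k l \<beta> \<beta>r Tinf Td a \<ge> M"
proof -
  obtain \<delta> where \<delta>: "\<delta> > 0" and bound: "\<And>C t. 0 < C \<Longrightarrow> C \<le> a0 \<Longrightarrow> 0 \<le> t \<Longrightarrow> C * t \<le> l / 2 \<Longrightarrow>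
      k * pi * (Td - Tinf) * \<delta> * (a0 * cosh t)\<^sup>2 \<le> heat_flux k l \<beta> \<beta>r Tinf Td (spike C (C * t) a0)"
    using spike_heat_flux_ge[OF less_imp_le[OF \<open>k > 0\<close>] assms(2-6)] by metis
  define \<kappa> where "\<kappa> = k * pi * (Td - Tinf) * \<delta> * a0\<^sup>2"
  have \<kappa>: "\<kappa> > 0" using assms \<delta> by (simp add: \<kappa>_def)
  \<comment> \<open>The flux is at least \<kappa> (cosh t)^2, and (cosh t)^2 is at least t / 4.\<close>
  define t where "t = 4 * \<bar>M\<bar> / \<kappa>"
  have t: "t \<ge> 0" using \<kappa> by (simp add: t_def)
  define C where "C = Min {a0, l / (2 * (1 + t)), (V0 - l * a0\<^sup>2) / ((1 + t) * (a0 * exp t)\<^sup>2)}"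
  have pos: "0 < (1 + t) * (a0 * exp t)\<^sup>2" using t \<open>a0 > 0\<close> by simp
  have C: "0 < C" "C \<le> a0" "C \<le> l / (2 * (1 + t))" "C \<le> (V0 - l * a0\<^sup>2) / ((1 + t) * (a0 * exp t)\<^sup>2)"
    using assms t pos by (auto simp: C_def)
  have "C * (1 + t) \<le> l / 2"
    using C(3) t by (simp add: field_simps)
  then have small: "C * t \<le> l / 2"
    using C(1) by (simp add: distrib_left)
  have "C * t * (a0 * exp t)\<^sup>2 \<le> C * ((1 + t) * (a0 * exp t)\<^sup>2)"
    using C(1) by (simp add: algebra_simps)
  also have "\<dots> \<le> V0 - l * a0\<^sup>2"
    using C(4) pos by (simp only: pos_le_divide_eq)
  finally have "spike C (C * t) a0 \<in> admissible a0 l V0"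
    using small \<open>l > 0\<close> by (intro spike_admissible[OF C(1,2) refl t]) auto
  moreover have "M \<le> heat_flux k l \<beta> \<beta>r Tinf Td (spike C (C * t) a0)"
  proof -
    have "M \<le> \<kappa> * (t / 4)"
      using \<kappa> by (simp add: t_def)
    also have "t / 4 \<le> (cosh t)\<^sup>2"
    proof -
      have "(1 + t) / 2 \<le> exp t / 2"
        using exp_ge_add_one_self[of t] by (intro divide_right_mono) auto
      also have "\<dots> \<le> cosh t"
        by (simp add: cosh_field_def)
      finally have "(1 + t) / 2 \<le> cosh t" .
      then have "((1 + t) / 2)\<^sup>2 \<le> (cosh t)\<^sup>2"
        using t by (intro power_mono) auto
      moreover have "t / 4 \<le> ((1 + t) / 2)\<^sup>2"
        using t zero_le_power2[of t] by (simp add: power2_eq_square field_simps)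
      ultimately show ?thesis by simp
    qed
    then have "\<kappa> * (t / 4) \<le> \<kappa> * (cosh t)\<^sup>2"
      using \<kappa> by simp
    also have "\<dots> \<le> heat_flux k l \<beta> \<beta>r Tinf Td (spike C (C * t) a0)"
      using bound[OF C(1,2) t small] by (simp add: \<kappa>_def power_mult_distrib mult_ac)
    finally show ?thesis .
  qed
  ultimately show ?thesis by (rule that)
qed

theorem theorem1:
  fixes k \<beta> \<beta>r Tinf Td a0 l V0 :: real
  assumes "k > 0" and "\<beta> > 0" and "\<beta>r \<ge> 0" and "0 < Tinf" and "Tinf < Td"
    and "a0 > 0" and "l > 0" and "V0 > l * a0\<^sup>2"
  shows "(SUP a\<in>admissible a0 l V0. ereal (heat_flux k l \<beta> \<beta>r Tinf Td a)) = \<infinity>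
    \<and> \<not> (\<exists>a\<in>admissible a0 l V0. \<forall>b\<in>admissible a0 l V0.
           heat_flux k l \<beta> \<beta>r Tinf Td b \<le> heat_flux k l \<beta> \<beta>r Tinf Td a)"
proof
  note unbounded = heat_flux_unbounded[OF assms(1-3,5-8)]
  show "(SUP a\<in>admissible a0 l V0. ereal (heat_flux k l \<beta> \<beta>r Tinf Td a)) = \<infinity>"
  proof (rule SUP_PInfty)
    fix n :: nat
    obtain a where "a \<in> admissible a0 l V0" "heat_flux k l \<beta> \<beta>r Tinf Td a \<ge> real n"
      using unbounded by blast
    then show "\<exists>a\<in>admissible a0 l V0. ereal (real n) \<le> ereal (heat_flux k l \<beta> \<beta>r Tinf Td a)"
      by auto
  qed
  show "\<not> (\<exists>a\<in>admissible a0 l V0. \<forall>b\<in>admissible a0 l V0.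
      heat_flux k l \<beta> \<beta>r Tinf Td b \<le> heat_flux k l \<beta> \<beta>r Tinf Td a)"
  proof
    assume "\<exists>a\<in>admissible a0 l V0. \<forall>b\<in>admissible a0 l V0.
      heat_flux k l \<beta> \<beta>r Tinf Td b \<le> heat_flux k l \<beta> \<beta>r Tinf Td a"
    then obtain a where "\<And>b. b \<in> admissible a0 l V0 \<Longrightarrow>
        heat_flux k l \<beta> \<beta>r Tinf Td b \<le> heat_flux k l \<beta> \<beta>r Tinf Td a" by blast
    moreover obtain b where "b \<in> admissible a0 l V0"
      "heat_flux k l \<beta> \<beta>r Tinf Td b \<ge> heat_flux k l \<beta> \<beta>r Tinf Td a + 1"
      using unbounded by blast
    ultimately show False by force
  qed
qed

end
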